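(* For every integer $r \ge 3$ and positive integers $s_1 \le s_2 \le \ldots \le s_r$, we have $$\mathrm{ex}(n, K_r, K_{s_1,s_2,\ldots, s_r}) = o\left(n^{r - 1/\prod_{i=1}^{r-1}s_i}\right) \quad \text{as } n \to \infty.$$
   Context: For graphs $F$ and $H$, the generalized Turán number $\mathrm{ex}(n,F,H)$ is the maximum number of (unlabeled) copies of $F$ in an $n$-vertex graph containing no subgraph isomorphic to $H$. $K_r$ denotes the complete graph on $r$ vertices, and $K_{s_1,\ldots,s_r}$ denotes the complete $r$-partite graph with parts of sizes $s_1,\ldots,s_r$. *)

theory Defs
  imports "HOL-Analysis.Analysis" "HOL-Library.Landau_Symbols" "Graph_Theory.Graph_Theory"
begin

text \<open>
  Following \<^theory>\<open>Graph_Theory.Pair_Digraph\<close>, a finite simple graph is a \<^typ>\<open>'a pair_pre_digraph\<close>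
  satisfying \<^locale>\<open>pair_graph\<close>: finite, loop-free and symmetric, so that an undirected edge
  is a pair of opposite arcs.
\<close>

definition complete_graph :: "nat \<Rightarrow> nat pair_pre_digraph" where
  "complete_graph r = \<lparr>pverts = {..<r}, parcs = {(u, v). u < r \<and> v < r \<and> u \<noteq> v}\<rparr>"

text \<open>The vertex \<^term>\<open>(i, j)\<close> is the \<^term>\<open>j\<close>-th vertex of the \<^term>\<open>i\<close>-th part.\<close>

definition complete_multipartite_graph :: "nat \<Rightarrow> (nat \<Rightarrow> nat) \<Rightarrow> (nat \<times> nat) pair_pre_digraph" where
  "complete_multipartite_graph r s =
     (let V = (SIGMA i:{1..r}. {..<s i})
      in \<lparr>pverts = V, parcs = {(u, v). u \<in> V \<and> v \<in> V \<and> fst u \<noteq> fst v}\<rparr>)"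

text \<open>
  The unlabeled copies of \<^term>\<open>F\<close> in \<^term>\<open>G\<close>: the (not necessarily induced) subgraphs of
  \<^term>\<open>G\<close> isomorphic to \<^term>\<open>F\<close>.
\<close>

definition copies :: "'a pair_pre_digraph \<Rightarrow> 'b pair_pre_digraph \<Rightarrow> 'b pair_pre_digraph set" where
  "copies F G = {F'. subgraph (with_proj F') (with_proj G) \<and> digraph_iso (with_proj F) (with_proj F')}"

definition graph_free :: "'a pair_pre_digraph \<Rightarrow> 'b pair_pre_digraph \<Rightarrow> bool" where
  "graph_free H G \<longleftrightarrow> copies H G = {}"

text \<open>
  Every finite graph is isomorphic to one with vertices in \<^typ>\<open>nat\<close>, so this type of host
  graphs is no restriction. The maximum is meaningful as soon as some \<^term>\<open>n\<close>-vertex graph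
  is \<^term>\<open>H\<close>-free, in particular if \<^term>\<open>H\<close> has an edge; see
  \<open>gen_turan_finite\<close> and \<open>gen_turan_nonempty\<close> below.
\<close>

definition gen_turan :: "nat \<Rightarrow> 'a pair_pre_digraph \<Rightarrow> 'b pair_pre_digraph \<Rightarrow> nat" where
  "gen_turan n F H =
     Max {card (copies F G) | G :: nat pair_pre_digraph.
            pair_graph G \<and> card (pverts G) = n \<and> graph_free H G}"

lemma complete_digraph_complete_graph: "complete_digraph r (with_proj (complete_graph r))"
  by (auto simp: complete_digraph_pair_def complete_graph_def)

lemma pair_graph_complete_graph: "pair_graph (complete_graph r)"
  by (rule pair_graphI_complete[OF complete_digraph_complete_graph])

lemma pair_graph_complete_multipartite_graph: "pair_graph (complete_multipartite_graph r s)"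
proof -
  let ?V = "SIGMA i:{1..r}. {..<s i}"
  have "finite {(u, v). u \<in> ?V \<and> v \<in> ?V \<and> fst u \<noteq> fst v}"
    by (rule finite_subset[of _ "?V \<times> ?V"]) auto
  then show ?thesis
    by unfold_locales
      (auto simp: complete_multipartite_graph_def Let_def symmetric_def intro!: symI)
qed

lemma copies_bound:
  fixes F :: "'a pair_pre_digraph" and G :: "'b pair_pre_digraph"
  assumes "pair_graph G"
  shows "finite (copies F G)" "card (copies F G) \<le> 2 ^ (card (pverts G) + card (pverts G) ^ 2)"
proof -
  interpret pair_graph G by fact
  let ?V = "pverts G"
  let ?f = "\<lambda>H :: 'b pair_pre_digraph. (pverts H, parcs H)"
  have inj: "inj_on ?f (copies F G)"
    by (auto simp: inj_on_def intro: pair_pre_digraph.equality)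
  have sub: "?f ` copies F G \<subseteq> Pow ?V \<times> Pow (?V \<times> ?V)"
    using arc_fst_in_verts arc_snd_in_verts
    by (fastforce simp: copies_def subgraph_def)
  have fin: "finite (Pow ?V \<times> Pow (?V \<times> ?V))"
    using pair_finite_verts by auto
  show "finite (copies F G)"
    using finite_imageD[OF finite_subset[OF sub fin] inj] .
  have "card (copies F G) = card (?f ` copies F G)"
    using card_image[OF inj] by simp
  also have "\<dots> \<le> card (Pow ?V \<times> Pow (?V \<times> ?V))"
    by (rule card_mono[OF fin sub])
  also have "\<dots> = 2 ^ (card ?V + card ?V ^ 2)"
    using pair_finite_verts
    by (simp add: card_cartesian_product card_Pow power_add power2_eq_square)
  finally show "card (copies F G) \<le> 2 ^ (card ?V + card ?V ^ 2)" .
qed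

lemma gen_turan_finite:
  "finite {card (copies F G) | G :: nat pair_pre_digraph.
            pair_graph G \<and> card (pverts G) = n \<and> graph_free H G}"
  by (rule finite_subset[of _ "{..2 ^ (n + n ^ 2)}"]) (auto dest: copies_bound)

lemma gen_turan_nonempty:
  assumes "parcs H \<noteq> {}"
  shows "{card (copies F G) | G :: nat pair_pre_digraph.
            pair_graph G \<and> card (pverts G) = n \<and> graph_free H G} \<noteq> {}"
proof -
  let ?G = "\<lparr>pverts = {..<n}, parcs = {}\<rparr>"
  have "pair_graph ?G"
    by unfold_locales (auto simp: symmetric_def intro!: symI)
  moreover have "graph_free H ?G"
  proof -
    have False if "F' \<in> copies H ?G" for F'
    proof -
      from that have e: "parcs F' = {}" and i: "digraph_iso (with_proj H) (with_proj F')"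
        by (auto simp: copies_def subgraph_def)
      from i obtain f where "with_proj F' = app_iso f (with_proj H)"
        by (auto simp: digraph_iso_def)
      then have "parcs F' = iso_arcs f ` parcs H"
        by (metis arcs_app_iso with_proj_simps(2))
      with e assms show False by simp
    qed
    then show ?thesis by (auto simp: graph_free_def)
  qed
  ultimately show ?thesis by (auto intro!: exI[of _ ?G])
qed

end

theory Submission
  imports Defs
begin

text \<open>
  Fix a set \<open>A\<close> of at most \<open>\<delta> n\<^sup>r\<^sup>-\<^sup>1\<close> tuples of \<open>r - 1\<close> vertices, and consider the ordered
  \<open>r\<close>-cliques \<open>(x, t)\<close> with \<open>t\<close> in \<open>A\<close>. Blow up the entries of \<open>t\<close>, one after the other, to sets
  of sizes \<open>s\<^sub>1, \<dots>, s\<^sub>r\<^sub>-\<^sub>1\<close>. If \<open>S\<close> is the sum of these sizes, then the graph being free of the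
  complete \<open>r\<close>-partite graph leaves only \<open>O(\<delta> n\<^sup>S)\<close> such configurations, because every base
  contains a tuple from \<open>A\<close> and has fewer than \<open>s\<^sub>r\<close> common extensions. By convexity there are
  at most \<open>C (\<delta> / n)\<^sup>1\<^sup>/\<^sup>p n\<^sup>r\<close> cliques of this kind, where \<open>p\<close> is the product of
  \<open>s\<^sub>1, \<dots>, s\<^sub>r\<^sub>-\<^sub>1\<close>.

  If \<open>A\<close> is everything, this shows that there are \<open>o(n\<^sup>r)\<close> cliques in all. Hence, for almost all
  \<open>w\<close>, the common link of an \<open>(r - 3)\<close>-tuple \<open>w\<close> has \<open>o(n\<^sup>3)\<close> triangles, and the triangle removal
  lemma provides \<open>o(n\<^sup>2)\<close> edges meeting them. The tuples \<open>(x, y, w)\<close> with \<open>xy\<close> such an edge form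
  a set \<open>A\<close> with arbitrarily small \<open>\<delta>\<close>, and every clique can be reordered to have its tail in
  \<open>A\<close>. Only triangles need to be removed, even though \<open>r\<close> is arbitrary.
\<close>

section \<open>The regularity and triangle removal lemmas\<close>

definition cond_exp :: "'a set \<Rightarrow> ('a \<Rightarrow> 'b) \<Rightarrow> ('a \<Rightarrow> real) \<Rightarrow> 'a \<Rightarrow> real" where
  "cond_exp W c f w = (\<Sum>v\<in>{v\<in>W. c v = c w}. f v) / card {v\<in>W. c v = c w}"

lemma cond_exp_cong: "c v = c w \<Longrightarrow> cond_exp W c f v = cond_exp W c f w"
  by (simp add: cond_exp_def)

lemma sum_fibres:
  assumes "finite W"
  shows "(\<Sum>w\<in>W. f w) = (\<Sum>b\<in>c ` W. \<Sum>w\<in>{w\<in>W. c w = b}. f w)"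
  by (rule sum.group[symmetric]) (use assms in auto)

lemma sum_cond_exp_mult:
  assumes W: "finite W" and h: "\<And>v w. v \<in> W \<Longrightarrow> w \<in> W \<Longrightarrow> c v = c w \<Longrightarrow> h v = h w"
  shows "(\<Sum>w\<in>W. cond_exp W c f w * h w) = (\<Sum>w\<in>W. f w * h w)"
proof -
  have "(\<Sum>w\<in>{w\<in>W. c w = b}. cond_exp W c f w * h w) = (\<Sum>w\<in>{w\<in>W. c w = b}. f w * h w)"
    if "b \<in> c ` W" for b
  proof -
    let ?D = "{w\<in>W. c w = b}"
    from that obtain u where u: "u \<in> W" "b = c u" by blast
    have "card ?D \<noteq> 0" using u W by auto
    have hu: "h w = h u" if "w \<in> ?D" for w using h[of w u] u that by simp
    have "(\<Sum>w\<in>?D. cond_exp W c f w * h w) = (\<Sum>w\<in>?D. (sum f ?D / card ?D) * h u)"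
    proof (rule sum.cong[OF refl])
      fix w assume w: "w \<in> ?D"
      then show "cond_exp W c f w * h w = (sum f ?D / card ?D) * h u"
        unfolding hu[OF w] by (simp add: cond_exp_def)
    qed
    also have "\<dots> = sum f ?D * h u" using \<open>card ?D \<noteq> 0\<close> by simp
    also have "\<dots> = (\<Sum>w\<in>?D. f w * h w)"
      unfolding sum_distrib_right by (rule sum.cong[OF refl]) (simp only: hu)
    finally show ?thesis .
  qed
  then show ?thesis
    unfolding sum_fibres[OF W, of _ c] by (rule sum.cong[OF refl])
qed

lemma cond_exp_pythagoras:
  assumes W: "finite W" and ref: "\<And>v w. v \<in> W \<Longrightarrow> w \<in> W \<Longrightarrow> c' v = c' w \<Longrightarrow> c v = c w"
  shows "(\<Sum>w\<in>W. (cond_exp W c' f w)\<^sup>2) =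
    (\<Sum>w\<in>W. (cond_exp W c f w)\<^sup>2) + (\<Sum>w\<in>W. (cond_exp W c' f w - cond_exp W c f w)\<^sup>2)"
proof -
  let ?g = "cond_exp W c f" and ?g' = "cond_exp W c' f"
  have "(\<Sum>w\<in>W. ?g' w * ?g w) = (\<Sum>w\<in>W. f w * ?g w)"
    by (rule sum_cond_exp_mult[OF W]) (use ref cond_exp_cong[of c] in blast)
  also have "\<dots> = (\<Sum>w\<in>W. ?g w * ?g w)"
    by (rule sum_cond_exp_mult[OF W, symmetric]) (rule cond_exp_cong)
  finally have "(\<Sum>w\<in>W. ?g' w * ?g w) = (\<Sum>w\<in>W. ?g w * ?g w)" .
  moreover have "(\<Sum>w\<in>W. (?g' w - ?g w)\<^sup>2) =
      (\<Sum>w\<in>W. ?g' w * ?g' w) + (\<Sum>w\<in>W. ?g w * ?g w) - 2 * (\<Sum>w\<in>W. ?g' w * ?g w)"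
    by (simp add: algebra_simps sum.distrib sum_subtractf power2_eq_square sum_distrib_left)
  ultimately show ?thesis by (simp add: power2_eq_square)
qed

lemma cond_exp_bounds:
  assumes "finite W" "\<And>w. w \<in> W \<Longrightarrow> 0 \<le> f w" "\<And>w. w \<in> W \<Longrightarrow> f w \<le> 1"
  shows "0 \<le> cond_exp W c f w" "cond_exp W c f w \<le> 1"
proof -
  let ?D = "{v\<in>W. c v = c w}"
  show "0 \<le> cond_exp W c f w"
    unfolding cond_exp_def by (intro divide_nonneg_nonneg sum_nonneg) (use assms in auto)
  have "sum f ?D \<le> (\<Sum>v\<in>?D. 1)" by (rule sum_mono) (use assms in auto)
  then show "cond_exp W c f w \<le> 1"
    unfolding cond_exp_def by (auto simp: divide_le_eq_1)
qed

text \<open>A family \<open>F\<close> of sets encodes the partition of the vertex set into its atoms, so that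
  adjoining sets to \<open>F\<close> refines the partition.\<close>

definition atom_of :: "'a set set \<Rightarrow> 'a \<Rightarrow> 'a set set" where
  "atom_of F x = {S\<in>F. x \<in> S}"

definition pair_atom :: "'a set set \<Rightarrow> 'a \<times> 'a \<Rightarrow> 'a set set \<times> 'a set set" where
  "pair_atom F = map_prod (atom_of F) (atom_of F)"

definition cell :: "'a set \<Rightarrow> 'a set set \<Rightarrow> 'a \<Rightarrow> 'a set" where
  "cell V F x = {y\<in>V. atom_of F y = atom_of F x}"

abbreviation cell_density :: "'a set \<Rightarrow> 'a set set \<Rightarrow> ('a \<times> 'a \<Rightarrow> real) \<Rightarrow> 'a \<times> 'a \<Rightarrow> real" where
  "cell_density V F f \<equiv> cond_exp (V \<times> V) (pair_atom F) f"

text \<open>The discrepancy on the subrectangle \<open>P\<close> is measured against the size of the whole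
  rectangle of cells, so that no lower bound on the size of \<open>P\<close> is needed.\<close>

definition irregular_witness ::
  "'a set \<Rightarrow> ('a \<times> 'a \<Rightarrow> real) \<Rightarrow> real \<Rightarrow> 'a set set \<Rightarrow> 'a set set \<times> 'a set set \<Rightarrow> 'a set \<times> 'a set \<Rightarrow> bool" where
  "irregular_witness V f e F ab P \<longleftrightarrow>
     fst P \<subseteq> {x\<in>V. atom_of F x = fst ab} \<and> snd P \<subseteq> {y\<in>V. atom_of F y = snd ab} \<and>
     e * card {w\<in>V \<times> V. pair_atom F w = ab} < \<bar>\<Sum>w\<in>fst P \<times> snd P. f w - cell_density V F f w\<bar>"

definition irregular_pairs :: "'a set \<Rightarrow> ('a \<times> 'a \<Rightarrow> real) \<Rightarrow> real \<Rightarrow> 'a set set \<Rightarrow> ('a \<times> 'a) set" where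
  "irregular_pairs V f e F = {w\<in>V \<times> V. \<exists>P. irregular_witness V f e F (pair_atom F w) P}"

lemma pair_atom_refine:
  assumes "F \<subseteq> F'" "pair_atom F' v = pair_atom F' w"
  shows "pair_atom F v = pair_atom F w"
proof -
  have "atom_of F x = atom_of F' x \<inter> F" for x :: 'a using assms(1) by (auto simp: atom_of_def)
  then show ?thesis using assms(2) by (auto simp: pair_atom_def prod_eq_iff)
qed

lemma card_atoms:
  assumes "finite F"
  shows "finite (atom_of F ` V)" "card (atom_of F ` V) \<le> 2 ^ card F"
proof -
  have sub: "atom_of F ` V \<subseteq> Pow F" by (auto simp: atom_of_def)
  then show "finite (atom_of F ` V)" using assms finite_subset by blast
  show "card (atom_of F ` V) \<le> 2 ^ card F"
    using card_mono[OF _ sub] assms by (simp add: card_Pow)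
qed

lemma energy_increment:
  fixes e :: real
  assumes V: "finite V" and F: "finite F" and e: "e > 0"
    and irr: "e * (card V)\<^sup>2 < card (irregular_pairs V f e F)"
  obtains F' where "finite F'" "card F' \<le> card F + 2 * (2 ^ card F)\<^sup>2" 
    "(\<Sum>w\<in>V\<times>V. (cell_density V F' f w)\<^sup>2) \<ge> (\<Sum>w\<in>V\<times>V. (cell_density V F f w)\<^sup>2) + e^3 * (card V)\<^sup>2"
proof -
  let ?W = "V \<times> V" and ?c = "pair_atom F" and ?I = "irregular_pairs V f e F"
  define B where "B = ?c ` ?I"
  have finI: "finite ?I" using V by (auto simp: irregular_pairs_def)
  have "\<forall>ab\<in>B. \<exists>P. irregular_witness V f e F ab P"
    by (auto simp: B_def irregular_pairs_def)
  then obtain P where P: "\<And>ab. ab \<in> B \<Longrightarrow> irregular_witness V f e F ab (P ab)" by metis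
  define F' where "F' = F \<union> (fst \<circ> P) ` B \<union> (snd \<circ> P) ` B"
  have Bsub: "B \<subseteq> (atom_of F ` V) \<times> (atom_of F ` V)"
    by (auto simp: B_def irregular_pairs_def pair_atom_def)
  have finB: "finite B" using finI by (simp add: B_def)
  have "card B \<le> card ((atom_of F ` V) \<times> (atom_of F ` V))"
    by (rule card_mono) (use Bsub card_atoms[OF F] in auto)
  also have "\<dots> \<le> (2 ^ card F)\<^sup>2"
    using card_atoms[OF F, of V] by (auto simp: card_cartesian_product power2_eq_square intro: mult_mono)
  finally have cB: "card B \<le> (2 ^ card F)\<^sup>2" .
  have "card F' \<le> card F + card ((fst \<circ> P) ` B) + card ((snd \<circ> P) ` B)"
    unfolding F'_def by (metis (no_types, lifting) add_le_mono card_Un_le le_trans order_refl)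
  also have "\<dots> \<le> card F + 2 * (2 ^ card F)\<^sup>2"
    using cB card_image_le[OF finB, of "fst \<circ> P"] card_image_le[OF finB, of "snd \<circ> P"] by linarith
  finally have cF': "card F' \<le> card F + 2 * (2 ^ card F)\<^sup>2" .
  have finF': "finite F'" using F finB by (simp add: F'_def)
  let ?g = "cell_density V F f" and ?g' = "cell_density V F' f"
  let ?D = "\<lambda>ab. {w\<in>?W. ?c w = ab}"
  have sub: "F \<subseteq> F'" by (auto simp: F'_def)
  have gain: "(\<Sum>w\<in>?D ab. (?g' w - ?g w)\<^sup>2) \<ge> e\<^sup>2 * card (?D ab)" if ab: "ab \<in> B" for ab
  proof -
    define Q where "Q = fst (P ab) \<times> snd (P ab)"
    have w: "irregular_witness V f e F ab (P ab)" using P[OF ab] .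
    have QD: "Q \<subseteq> ?D ab"
      using w by (auto simp: irregular_witness_def Q_def pair_atom_def prod_eq_iff)
    have fD: "finite (?D ab)" using V by auto
    have fQ: "finite Q" using finite_subset[OF QD fD] .
    have QW: "Q \<subseteq> ?W" using QD by auto
    have h: "indicator Q v = (indicator Q w :: real)" if "pair_atom F' v = pair_atom F' w" for v w
    proof -
      have "fst (P ab) \<in> F'" "snd (P ab) \<in> F'" using ab by (auto simp: F'_def)
      then have "v \<in> Q \<longleftrightarrow> w \<in> Q"
        using that by (cases v; cases w) (auto simp: Q_def pair_atom_def atom_of_def set_eq_iff)
      then show ?thesis by (simp add: indicator_def)
    qed
    have "(\<Sum>w\<in>?W. ?g' w * indicator Q w) = (\<Sum>w\<in>?W. f w * indicator Q w)"
      by (rule sum_cond_exp_mult[OF finite_cartesian_product[OF V V] h])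
    moreover have "(\<Sum>w\<in>?W. k w * indicator Q w) = sum k Q" for k :: "'a \<times> 'a \<Rightarrow> real"
      by (rule sum.mono_neutral_cong_right) (use V QW in auto)
    ultimately have eq: "sum ?g' Q = sum f Q" by simp
    have "e * card (?D ab) < \<bar>\<Sum>w\<in>Q. ?g' w - ?g w\<bar>"
      using w eq by (simp add: irregular_witness_def Q_def sum_subtractf)
    then have "(e * card (?D ab))\<^sup>2 \<le> (\<Sum>w\<in>Q. ?g' w - ?g w)\<^sup>2"
      using e by (simp add: abs_le_square_iff[symmetric])
    also have "\<dots> \<le> (\<Sum>w\<in>Q. (?g' w - ?g w)\<^sup>2) * card Q"
      using Cauchy_Schwarz_ineq_sum[of "\<lambda>w. ?g' w - ?g w" "\<lambda>_. 1" Q] by simp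
    also have "\<dots> \<le> (\<Sum>w\<in>?D ab. (?g' w - ?g w)\<^sup>2) * card (?D ab)"
      by (intro mult_mono sum_mono2 of_nat_mono card_mono QD fD sum_nonneg) auto
    finally have *: "(e\<^sup>2 * card (?D ab)) * card (?D ab) \<le> (\<Sum>w\<in>?D ab. (?g' w - ?g w)\<^sup>2) * card (?D ab)"
      by (simp add: power2_eq_square algebra_simps)
    have "card (?D ab) > 0" using ab fD by (auto simp: B_def irregular_pairs_def card_gt_0_iff)
    then show ?thesis using * by simp
  qed
  have "e^3 * (card V)\<^sup>2 = e\<^sup>2 * (e * (card V)\<^sup>2)" by (simp add: power3_eq_cube power2_eq_square)
  also have "\<dots> \<le> e\<^sup>2 * card ?I" using irr e by (intro mult_left_mono) auto
  also have "card ?I \<le> (\<Sum>ab\<in>B. card (?D ab))"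
  proof -
    have "?I \<subseteq> (\<Union>ab\<in>B. ?D ab)" by (auto simp: B_def irregular_pairs_def)
    then have "card ?I \<le> card (\<Union>ab\<in>B. ?D ab)" by (rule card_mono[rotated]) (use finB V in auto)
    also have "\<dots> \<le> (\<Sum>ab\<in>B. card (?D ab))" by (rule card_UN_le[OF finB])
    finally show ?thesis .
  qed
  also have "e\<^sup>2 * real (\<Sum>ab\<in>B. card (?D ab)) \<le> (\<Sum>ab\<in>B. \<Sum>w\<in>?D ab. (?g' w - ?g w)\<^sup>2)"
    unfolding of_nat_sum sum_distrib_left by (rule sum_mono) (rule gain)
  also have "\<dots> \<le> (\<Sum>ab\<in>?c ` ?W. \<Sum>w\<in>?D ab. (?g' w - ?g w)\<^sup>2)"
    by (rule sum_mono2) (use V in \<open>auto simp: B_def irregular_pairs_def intro: sum_nonneg\<close>)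
  also have "\<dots> = (\<Sum>w\<in>?W. (?g' w - ?g w)\<^sup>2)"
    by (rule sum_fibres[symmetric]) (use V in auto)
  finally have "e^3 * (card V)\<^sup>2 \<le> (\<Sum>w\<in>?W. (?g' w - ?g w)\<^sup>2)"
    by (simp add: mult_left_mono)
  moreover have "(\<Sum>w\<in>?W. (?g' w)\<^sup>2) = (\<Sum>w\<in>?W. (?g w)\<^sup>2) + (\<Sum>w\<in>?W. (?g' w - ?g w)\<^sup>2)"
    by (rule cond_exp_pythagoras[OF finite_cartesian_product[OF V V] pair_atom_refine[OF sub]])
  ultimately show thesis using that[OF finF' cF'] by simp
qed

lemma regularity:
  fixes e :: real
  assumes e: "e > 0"
  obtains M :: nat where
    "\<And>(V :: 'a set) f. finite V \<Longrightarrow> (\<And>w. w \<in> V \<times> V \<Longrightarrow> 0 \<le> f w \<and> f w \<le> 1) \<Longrightarrow>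
       \<exists>F. finite F \<and> card F \<le> M \<and> card (irregular_pairs V f e F) \<le> e * (card V)\<^sup>2"
proof -
  have step: "\<exists>M::nat. \<forall>(V :: 'a set) f. finite V \<longrightarrow>
      (\<exists>F. finite F \<and> card F \<le> M \<and> (card (irregular_pairs V f e F) \<le> e * (card V)\<^sup>2 \<or>
        j * e^3 * (card V)\<^sup>2 \<le> (\<Sum>w\<in>V\<times>V. (cell_density V F f w)\<^sup>2)))" for j :: nat
  proof (induction j)
    case 0
    show ?case
      by (rule exI[of _ 0]) (auto intro!: exI[of _ "{}"] sum_nonneg)
  next
    case (Suc j)
    then obtain M :: nat where M: "\<And>(V :: 'a set) f. finite V \<Longrightarrow>
      (\<exists>F. finite F \<and> card F \<le> M \<and> (card (irregular_pairs V f e F) \<le> e * (card V)\<^sup>2 \<or>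
        j * e^3 * (card V)\<^sup>2 \<le> (\<Sum>w\<in>V\<times>V. (cell_density V F f w)\<^sup>2)))" by blast
    let ?M = "M + 2 * (2 ^ M)\<^sup>2"
    have "\<exists>F. finite F \<and> card F \<le> ?M \<and> (card (irregular_pairs V f e F) \<le> e * (card V)\<^sup>2 \<or>
        Suc j * e^3 * (card V)\<^sup>2 \<le> (\<Sum>w\<in>V\<times>V. (cell_density V F f w)\<^sup>2))"
      if V: "finite V" for V :: "'a set" and f
    proof -
      obtain F where F: "finite F" "card F \<le> M" and
        or: "card (irregular_pairs V f e F) \<le> e * (card V)\<^sup>2 \<or>
        j * e^3 * (card V)\<^sup>2 \<le> (\<Sum>w\<in>V\<times>V. (cell_density V F f w)\<^sup>2)" using M[OF V] by blast
      show ?thesis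
      proof (cases "card (irregular_pairs V f e F) \<le> e * (card V)\<^sup>2")
        case True
        then show ?thesis using F by (intro exI[of _ F]) auto
      next
        case False
        then obtain F' where F': "finite F'" "card F' \<le> card F + 2 * (2 ^ card F)\<^sup>2" 
          "(\<Sum>w\<in>V\<times>V. (cell_density V F' f w)\<^sup>2) \<ge> (\<Sum>w\<in>V\<times>V. (cell_density V F f w)\<^sup>2) + e^3 * (card V)\<^sup>2"
          using energy_increment[OF V F(1) e, of f] by force
        have "card F + 2 * (2 ^ card F)\<^sup>2 \<le> ?M"
          using F(2) by (intro add_mono mult_left_mono power_mono power_increasing) auto
        moreover have "Suc j * e^3 * (card V)\<^sup>2 = j * e^3 * (card V)\<^sup>2 + e^3 * (card V)\<^sup>2"
          by (simp add: algebra_simps)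
        ultimately show ?thesis using F' or False by (intro exI[of _ F']) auto
      qed
    qed
    then show ?case by blast
  qed
  obtain j :: nat where j: "1 / e^3 < j" using reals_Archimedean2 by blast
  obtain M :: nat where M: "\<And>(V :: 'a set) f. finite V \<Longrightarrow>
      (\<exists>F. finite F \<and> card F \<le> M \<and> (card (irregular_pairs V f e F) \<le> e * (card V)\<^sup>2 \<or>
        j * e^3 * (card V)\<^sup>2 \<le> (\<Sum>w\<in>V\<times>V. (cell_density V F f w)\<^sup>2)))" using step[of j] by blast
  have "\<exists>F. finite F \<and> card F \<le> M \<and> card (irregular_pairs V f e F) \<le> e * (card V)\<^sup>2"
    if V: "finite V" and f: "\<And>w. w \<in> V \<times> V \<Longrightarrow> 0 \<le> f w \<and> f w \<le> 1" for V :: "'a set" and f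
  proof (cases "V = {}")
    case True
    then show ?thesis by (intro exI[of _ "{}"]) (simp add: irregular_pairs_def)
  next
    case False
    obtain F where F: "finite F" "card F \<le> M" and
        or: "card (irregular_pairs V f e F) \<le> e * (card V)\<^sup>2 \<or>
        j * e^3 * (card V)\<^sup>2 \<le> (\<Sum>w\<in>V\<times>V. (cell_density V F f w)\<^sup>2)" using M[OF V] by blast
    have "(\<Sum>w\<in>V\<times>V. (cell_density V F f w)\<^sup>2) \<le> (\<Sum>w\<in>V\<times>V. 1)"
      by (rule sum_mono) (use V f in \<open>auto intro!: power_le_one cond_exp_bounds\<close>)
    also have "\<dots> = (card V)\<^sup>2" by (simp add: card_cartesian_product power2_eq_square)
    also have "\<dots> < j * e^3 * (card V)\<^sup>2"
    proof -
      have "1 < j * e^3" using j e by (simp add: field_simps)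
      moreover have "(real (card V))\<^sup>2 > 0" using False V by auto
      ultimately show ?thesis by simp
    qed
    finally show ?thesis using or F by auto
  qed
  then show thesis using that by blast
qed


lemma triangle_counting:
  fixes e d1 d2 d3 :: real and f :: "'a \<times> 'a \<Rightarrow> real"
  assumes f_def: "\<And>w. f w = of_bool (w \<in> R)"
    and fin: "finite A" "finite B" "finite C"
    and d: "0 \<le> d1" "d1 \<le> 1" "0 \<le> d2" "d2 \<le> 1" and e: "0 \<le> e"
    and AB: "\<And>A' B'. A' \<subseteq> A \<Longrightarrow> B' \<subseteq> B \<Longrightarrow> \<bar>\<Sum>x\<in>A'. \<Sum>y\<in>B'. f (x, y) - d1\<bar> \<le> e * (card A * card B)"
    and BC: "\<And>B' C'. B' \<subseteq> B \<Longrightarrow> C' \<subseteq> C \<Longrightarrow> \<bar>\<Sum>y\<in>B'. \<Sum>z\<in>C'. f (y, z) - d2\<bar> \<le> e * (card B * card C)"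
    and AC: "\<And>A' C'. A' \<subseteq> A \<Longrightarrow> C' \<subseteq> C \<Longrightarrow> \<bar>\<Sum>x\<in>A'. \<Sum>z\<in>C'. f (x, z) - d3\<bar> \<le> e * (card A * card C)"
  shows "(\<Sum>x\<in>A. \<Sum>y\<in>B. \<Sum>z\<in>C. f (x, y) * f (y, z) * f (x, z)) \<ge> (d1 * d2 * d3 - 3 * e) * (card A * card B * card C)"
proof -
  let ?m = "real (card A * card B * card C)"
  have ind: "(\<Sum>x\<in>X. g x * of_bool (P x)) = sum g {x\<in>X. P x}" if "finite X"
    for X :: "'a set" and g :: "'a \<Rightarrow> real" and P
    by (rule sum.mono_neutral_cong_right) (use that in auto)
  have 1: "(\<Sum>x\<in>A. \<Sum>y\<in>B. \<Sum>z\<in>C. (f (x, y) - d1) * f (y, z) * f (x, z)) \<ge> - e * ?m"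
  proof -
    have "(\<Sum>x\<in>A. \<Sum>y\<in>B. \<Sum>z\<in>C. (f (x, y) - d1) * f (y, z) * f (x, z))
        = (\<Sum>x\<in>A. \<Sum>z\<in>C. \<Sum>y\<in>B. (f (x, y) - d1) * f (y, z) * f (x, z))"
      by (rule sum.cong[OF refl], rule sum.swap)
    also have "\<dots> = (\<Sum>z\<in>C. \<Sum>x\<in>A. \<Sum>y\<in>B. (f (x, y) - d1) * f (y, z) * f (x, z))"
      by (rule sum.swap)
    also have "\<dots> = (\<Sum>z\<in>C. \<Sum>x\<in>{x\<in>A. (x, z) \<in> R}. \<Sum>y\<in>{y\<in>B. (y, z) \<in> R}. f (x, y) - d1)"
      using fin by (simp add: f_def ind Int_def flip: sum_distrib_right)
    also have "\<dots> \<ge> (\<Sum>z\<in>C. - (e * (card A * card B)))"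
    proof (rule sum_mono)
      fix z
      show "- (e * (card A * card B)) \<le> (\<Sum>x\<in>{x\<in>A. (x, z) \<in> R}. \<Sum>y\<in>{y\<in>B. (y, z) \<in> R}. f (x, y) - d1)"
        using AB[of "{x\<in>A. (x, z) \<in> R}" "{y\<in>B. (y, z) \<in> R}"] by auto
    qed
    finally show ?thesis by (simp add: algebra_simps)
  qed
  have 2: "(\<Sum>x\<in>A. \<Sum>y\<in>B. \<Sum>z\<in>C. (f (y, z) - d2) * f (x, z)) \<ge> - e * ?m"
  proof -
    have "(\<Sum>x\<in>A. \<Sum>y\<in>B. \<Sum>z\<in>C. (f (y, z) - d2) * f (x, z))
        = (\<Sum>x\<in>A. \<Sum>y\<in>B. \<Sum>z\<in>{z\<in>C. (x, z) \<in> R}. f (y, z) - d2)"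
      using fin by (simp add: f_def ind Int_def)
    also have "\<dots> \<ge> (\<Sum>x\<in>A. - (e * (card B * card C)))"
    proof (rule sum_mono)
      fix x
      show "- (e * (card B * card C)) \<le> (\<Sum>y\<in>B. \<Sum>z\<in>{z\<in>C. (x, z) \<in> R}. f (y, z) - d2)"
        using BC[of B "{z\<in>C. (x, z) \<in> R}"] by auto
    qed
    finally show ?thesis by (simp add: algebra_simps)
  qed
  have 3: "(\<Sum>x\<in>A. \<Sum>y\<in>B. \<Sum>z\<in>C. f (x, z) - d3) \<ge> - e * ?m"
  proof -
    have "(\<Sum>x\<in>A. \<Sum>y\<in>B. \<Sum>z\<in>C. f (x, z) - d3) = (\<Sum>y\<in>B. \<Sum>x\<in>A. \<Sum>z\<in>C. f (x, z) - d3)"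
      by (rule sum.swap)
    also have "\<dots> \<ge> (\<Sum>y\<in>B. - (e * (card A * card C)))"
    proof (rule sum_mono)
      show "- (e * (card A * card C)) \<le> (\<Sum>x\<in>A. \<Sum>z\<in>C. f (x, z) - d3)"
        using AC[of A C] by auto
    qed
    finally show ?thesis by (simp add: algebra_simps)
  qed
  have *: "d * t \<ge> - e * ?m" if "0 \<le> d" "d \<le> 1" "t \<ge> - e * ?m" for d t :: real
  proof -
    have "d * (e * ?m) \<le> 1 * (e * ?m)" using that e by (intro mult_right_mono) auto
    moreover have "d * t \<ge> d * (- e * ?m)" using that by (intro mult_left_mono) auto
    ultimately show ?thesis by simp
  qed
  have "(\<Sum>x\<in>A. \<Sum>y\<in>B. \<Sum>z\<in>C. f (x, y) * f (y, z) * f (x, z)) =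
      (\<Sum>x\<in>A. \<Sum>y\<in>B. \<Sum>z\<in>C. (f (x, y) - d1) * f (y, z) * f (x, z) + d1 * ((f (y, z) - d2) * f (x, z))
        + d1 * d2 * (f (x, z) - d3) + d1 * d2 * d3)"
    by (intro sum.cong refl) (simp add: algebra_simps)
  also have "\<dots> = (\<Sum>x\<in>A. \<Sum>y\<in>B. \<Sum>z\<in>C. (f (x, y) - d1) * f (y, z) * f (x, z)) +
      d1 * (\<Sum>x\<in>A. \<Sum>y\<in>B. \<Sum>z\<in>C. (f (y, z) - d2) * f (x, z)) +
      d1 * d2 * (\<Sum>x\<in>A. \<Sum>y\<in>B. \<Sum>z\<in>C. f (x, z) - d3) + d1 * d2 * d3 * ?m"
    by (simp only: sum.distrib sum_distrib_left sum_constant of_nat_mult mult_ac)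
  also have "\<dots> \<ge> - e * ?m + - e * ?m + - e * ?m + d1 * d2 * d3 * ?m"
    using 1 *[OF d(1,2) 2] *[of "d1 * d2", OF _ _ 3] d by (intro add_mono) (auto intro: mult_le_one)
  finally show ?thesis by (simp add: algebra_simps)
qed

lemma sum_sparse_le:
  fixes f :: "'a \<Rightarrow> real"
  assumes W: "finite W" and e: "e \<ge> 0"
  shows "sum f {w\<in>W. cond_exp W c f w < e} \<le> e * card W"
proof -
  let ?S = "{w\<in>W. cond_exp W c f w < e}"
  have *: "(\<Sum>w\<in>W. g w * of_bool (cond_exp W c f w < e)) = sum g ?S" for g :: "'a \<Rightarrow> real"
    by (rule sum.mono_neutral_cong_right) (use W in auto)
  have "sum f ?S = sum (cond_exp W c f) ?S"
    unfolding *[symmetric] by (rule sum_cond_exp_mult[OF W, symmetric]) (metis cond_exp_cong)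
  also have "\<dots> \<le> (\<Sum>w\<in>?S. e)" by (rule sum_mono) simp
  also have "\<dots> \<le> e * card W"
    using W e by (auto simp: mult.commute intro!: mult_left_mono card_mono)
  finally show ?thesis .
qed

lemma card_small_cells_le:
  fixes t :: real
  assumes V: "finite V" and F: "finite F" "card F \<le> M" and t: "0 \<le> t"
  shows "card {x\<in>V. card (cell V F x) < t} \<le> 2 ^ M * t"
proof -
  let ?S = "{x\<in>V. card (cell V F x) < t}" and ?T = "atom_of F ` {x\<in>V. card (cell V F x) < t}"
  have "?S \<subseteq> (\<Union>a\<in>?T. {x\<in>V. atom_of F x = a})" by auto
  then have "card ?S \<le> card (\<Union>a\<in>?T. {x\<in>V. atom_of F x = a})"
    by (rule card_mono[rotated]) (use V in auto)
  also have "\<dots> \<le> (\<Sum>a\<in>?T. card {x\<in>V. atom_of F x = a})"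
    by (rule card_UN_le) (use V in auto)
  also have "real \<dots> \<le> (\<Sum>a\<in>?T. t)"
    unfolding of_nat_sum by (rule sum_mono) (auto simp: cell_def)
  also have "\<dots> = card ?T * t" by simp
  also have "\<dots> \<le> 2 ^ M * t"
  proof -
    have "card ?T \<le> 2 ^ card F" by (rule card_atoms(2)[OF F(1)])
    also have "\<dots> \<le> 2 ^ M" using F(2) by (intro power_increasing) auto
    finally have "real (card ?T) \<le> 2 ^ M" by (metis of_nat_le_iff of_nat_numeral of_nat_power)
    then show ?thesis using t by (intro mult_right_mono) auto
  qed
  finally show ?thesis by simp
qed

lemma regular_cells:
  assumes V: "finite V" and xy: "x \<in> V" "y \<in> V" "(x, y) \<notin> irregular_pairs V f e F"
    and sub: "A' \<subseteq> cell V F x" "B' \<subseteq> cell V F y"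
  shows "\<bar>\<Sum>u\<in>A'. \<Sum>v\<in>B'. f (u, v) - cell_density V F f (x, y)\<bar> \<le> e * (card (cell V F x) * card (cell V F y))"
proof -
  have "{w\<in>V \<times> V. pair_atom F w = pair_atom F (x, y)} = cell V F x \<times> cell V F y"
    by (auto simp: pair_atom_def cell_def)
  moreover have "\<not> irregular_witness V f e F (pair_atom F (x, y)) (A', B')"
    using xy by (auto simp: irregular_pairs_def)
  ultimately have "\<bar>\<Sum>w\<in>A' \<times> B'. f w - cell_density V F f w\<bar> \<le> e * (card (cell V F x) * card (cell V F y))"
    using sub by (auto simp: irregular_witness_def cell_def pair_atom_def card_cartesian_product not_less)
  also have "(\<Sum>w\<in>A' \<times> B'. f w - cell_density V F f w) = (\<Sum>w\<in>A' \<times> B'. f w - cell_density V F f (x, y))"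
  proof (intro sum.cong refl arg_cong2[of _ _ _ _ "(-)"] cond_exp_cong)
    fix w assume "w \<in> A' \<times> B'"
    then have "fst w \<in> cell V F x" "snd w \<in> cell V F y" using sub by auto
    then show "pair_atom F w = pair_atom F (x, y)"
      by (cases w) (simp add: pair_atom_def cell_def)
  qed
  also have "\<dots> = (\<Sum>u\<in>A'. \<Sum>v\<in>B'. f (u, v) - cell_density V F f (x, y))"
    by (simp add: sum.cartesian_product case_prod_unfold)
  finally show ?thesis .
qed

definition triangles :: "'a set \<Rightarrow> ('a \<times> 'a) set \<Rightarrow> ('a \<times> 'a \<times> 'a) set" where
  "triangles V R = {(x, y, z) \<in> V \<times> V \<times> V. (x, y) \<in> R \<and> (y, z) \<in> R \<and> (x, z) \<in> R}"

lemma triangle_removal: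
  fixes \<delta> :: real
  assumes \<delta>: "\<delta> > 0"
  obtains \<gamma> :: real where "\<gamma> > 0"
    "\<And>(V :: 'a set) R. finite V \<Longrightarrow> card (triangles V R) < \<gamma> * real (card V) ^ 3 \<Longrightarrow>
       \<exists>E \<subseteq> V \<times> V. card E \<le> \<delta> * (card V)\<^sup>2 \<and>
         (\<forall>(x, y, z) \<in> triangles V R. (x, y) \<in> E \<or> (y, z) \<in> E \<or> (x, z) \<in> E)"
proof -
  define d where "d = \<delta> / 4"
  define e where "e = min d (d ^ 3 / 6)"
  have d0: "d > 0" and e0: "e > 0" using \<delta> by (auto simp: d_def e_def)
  obtain M :: nat where M: "\<And>(V :: 'a set) f. finite V \<Longrightarrow> (\<And>w. w \<in> V \<times> V \<Longrightarrow> 0 \<le> f w \<and> f w \<le> 1) \<Longrightarrow>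
       \<exists>F. finite F \<and> card F \<le> M \<and> card (irregular_pairs V f e F) \<le> e * (card V)\<^sup>2"
    using regularity[OF e0, where 'a = 'a] by blast
  define \<eta> where "\<eta> = d / 2 ^ M"
  define \<gamma> where "\<gamma> = d ^ 3 / 2 * \<eta> ^ 3"
  have \<eta>0: "\<eta> > 0" and \<gamma>0: "\<gamma> > 0" using d0 by (auto simp: \<eta>_def \<gamma>_def)
  show thesis
  proof (rule that[OF \<gamma>0])
    fix V :: "'a set" and R
    assume V: "finite V" and few: "card (triangles V R) < \<gamma> * real (card V) ^ 3"
    define f where "f w = (of_bool (w \<in> R) :: real)" for w
    obtain F where F: "finite F" "card F \<le> M" and
      irr: "card (irregular_pairs V f e F) \<le> e * (card V)\<^sup>2"
      using M[OF V, of f] by (auto simp: f_def)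
    let ?n = "real (card V)" and ?d = "cell_density V F f"
    define small where "small = {x\<in>V. card (cell V F x) < \<eta> * ?n}"
    define sparse where "sparse = {w\<in>V\<times>V. ?d w < d}"
    define E where "E = irregular_pairs V f e F \<union> (sparse \<inter> R) \<union> small \<times> V \<union> V \<times> small"
    have VV: "finite (V \<times> V)" using V by simp
    have "card small \<le> 2 ^ M * (\<eta> * ?n)"
      unfolding small_def by (rule card_small_cells_le) (use V F \<eta>0 in auto)
    then have small: "card small \<le> d * ?n" by (simp add: \<eta>_def)
    have "card (small \<times> V) \<le> d * ?n\<^sup>2" "card (V \<times> small) \<le> d * ?n\<^sup>2"
      using mult_right_mono[OF small, of ?n]
      by (simp_all add: card_cartesian_product power2_eq_square mult_ac)
    moreover have "card (sparse \<inter> R) \<le> d * ?n\<^sup>2"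
    proof -
      have "card (sparse \<inter> R) = sum f sparse"
      proof -
        have "finite sparse" using VV by (simp add: sparse_def)
        then have "sum f sparse = (\<Sum>w\<in>sparse \<inter> R. 1)"
          by (intro sum.mono_neutral_cong_right) (auto simp: f_def)
        then show ?thesis by simp
      qed
      also have "\<dots> \<le> d * card (V \<times> V)"
        unfolding sparse_def by (rule sum_sparse_le[OF VV]) (use d0 in simp)
      finally show ?thesis by (simp add: card_cartesian_product power2_eq_square)
    qed
    moreover have "card (irregular_pairs V f e F) \<le> d * ?n\<^sup>2"
    proof -
      have "e * ?n\<^sup>2 \<le> d * ?n\<^sup>2" by (rule mult_right_mono) (auto simp: e_def)
      then show ?thesis using irr by simp
    qed
    moreover have "card E \<le> card (irregular_pairs V f e F) + card (sparse \<inter> R)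
      + card (small \<times> V) + card (V \<times> small)"
      unfolding E_def by (meson add_le_mono card_Un_le le_trans order_refl)
    ultimately have "card E \<le> \<delta> * ?n\<^sup>2" by (simp add: d_def)
    moreover have "E \<subseteq> V \<times> V" by (auto simp: E_def irregular_pairs_def sparse_def small_def)
    moreover have "(x, y) \<in> E \<or> (y, z) \<in> E \<or> (x, z) \<in> E" if xyz: "(x, y, z) \<in> triangles V R" for x y z
    proof (rule ccontr)
      assume no: "\<not> ?thesis"
      have in_V: "x \<in> V" "y \<in> V" "z \<in> V" and in_R: "(x, y) \<in> R" "(y, z) \<in> R" "(x, z) \<in> R"
        using xyz by (auto simp: triangles_def)
      let ?A = "cell V F x" and ?B = "cell V F y" and ?C = "cell V F z"
      let ?t = "real (card ?A * card ?B * card ?C)"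
      have big: "card ?A \<ge> \<eta> * ?n" "card ?B \<ge> \<eta> * ?n" "card ?C \<ge> \<eta> * ?n"
        using no in_V by (auto simp: E_def small_def not_less)
      have dense: "?d (x, y) \<ge> d" "?d (y, z) \<ge> d" "?d (x, z) \<ge> d"
        using no in_V in_R by (auto simp: E_def sparse_def not_less)
      have reg: "(x, y) \<notin> irregular_pairs V f e F" "(y, z) \<notin> irregular_pairs V f e F"
        "(x, z) \<notin> irregular_pairs V f e F" using no by (auto simp: E_def)
      have fin: "finite ?A" "finite ?B" "finite ?C" using V by (auto simp: cell_def)
      have bds: "0 \<le> ?d w" "?d w \<le> 1" for w
        by (rule cond_exp_bounds[OF VV]; simp add: f_def)+
      have "(?d (x, y) * ?d (y, z) * ?d (x, z) - 3 * e) * ?t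
          \<le> (\<Sum>u\<in>?A. \<Sum>v\<in>?B. \<Sum>w\<in>?C. f (u, v) * f (v, w) * f (u, w))"
        by (rule triangle_counting[OF f_def fin bds[of "(x, y)"] bds[of "(y, z)"] less_imp_le[OF e0]
              regular_cells[OF V in_V(1,2) reg(1)] regular_cells[OF V in_V(2,3) reg(2)]
              regular_cells[OF V in_V(1,3) reg(3)]])
      also have "\<dots> = card ((?A \<times> ?B \<times> ?C) \<inter> triangles V R)"
      proof -
        have "(\<Sum>u\<in>?A. \<Sum>v\<in>?B. \<Sum>w\<in>?C. f (u, v) * f (v, w) * f (u, w)) =
            (\<Sum>(u, v, w)\<in>?A \<times> ?B \<times> ?C. f (u, v) * f (v, w) * f (u, w))"
          by (simp add: sum.cartesian_product)
        also have "\<dots> = (\<Sum>p\<in>(?A \<times> ?B \<times> ?C) \<inter> triangles V R. 1)"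
          by (rule sum.mono_neutral_cong_right)
            (use fin in \<open>auto simp: f_def triangles_def cell_def\<close>)
        finally show ?thesis by simp
      qed
      also have "\<dots> \<le> card (triangles V R)"
      proof -
        have "triangles V R \<subseteq> V \<times> V \<times> V" by (auto simp: triangles_def)
        then have "finite (triangles V R)" using V finite_subset by blast
        then show ?thesis by (intro of_nat_mono card_mono) auto
      qed
      finally have le: "(?d (x, y) * ?d (y, z) * ?d (x, z) - 3 * e) * ?t \<le> card (triangles V R)" .
      have "d * d * d \<le> ?d (x, y) * ?d (y, z) * ?d (x, z)"
        using dense d0 by (intro mult_mono) auto
      then have "d ^ 3 / 2 \<le> ?d (x, y) * ?d (y, z) * ?d (x, z) - 3 * e"
        by (simp add: e_def power3_eq_cube min_def)
      moreover have "(\<eta> * ?n) * (\<eta> * ?n) * (\<eta> * ?n) \<le> ?t"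
        unfolding of_nat_mult using big \<eta>0 by (intro mult_mono) auto
      ultimately have "d ^ 3 / 2 * ((\<eta> * ?n) * (\<eta> * ?n) * (\<eta> * ?n)) \<le> card (triangles V R)"
        using d0 \<eta>0 by (intro order_trans[OF mult_mono' le]) auto
      then show False using few by (simp add: \<gamma>_def power3_eq_cube mult_ac)
    qed
    ultimately show "\<exists>E \<subseteq> V \<times> V. card E \<le> \<delta> * (card V)\<^sup>2 \<and>
         (\<forall>(x, y, z) \<in> triangles V R. (x, y) \<in> E \<or> (y, z) \<in> E \<or> (x, z) \<in> E)"
      by (intro exI[of _ E]) auto
  qed
qed

section \<open>Blow-ups of vertex tuples\<close>

definition set_families :: "'a set \<Rightarrow> nat list \<Rightarrow> 'a set list set" where
  "set_families V ss = {Xs. list_all2 (\<lambda>X s. X \<subseteq> V \<and> card X = s) Xs ss}"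

definition blowups :: "'a set \<Rightarrow> 'a list set \<Rightarrow> nat list \<Rightarrow> 'a set list set" where
  "blowups V T ss = {Xs \<in> set_families V ss. listset Xs \<subseteq> T}"

lemma mem_listset_iff: "xs \<in> listset Xs \<longleftrightarrow> list_all2 (\<in>) xs Xs"
  by (induction Xs arbitrary: xs) (auto simp: set_Cons_def list_all2_Cons2)

lemma listset_append_Cons: "listset (Ys @ X # Zs) = (\<Union>x\<in>X. listset (Ys @ {x} # Zs))"
  by (induction Ys) (auto simp: set_Cons_def)

lemma set_families_Nil [simp]: "set_families V [] = {[]}"
  by (auto simp: set_families_def)

lemma set_families_Cons:
  "set_families V (s # ss) = (\<lambda>(X, Xs). X # Xs) ` ({X. X \<subseteq> V \<and> card X = s} \<times> set_families V ss)"
proof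
  show "set_families V (s # ss) \<subseteq>
      (\<lambda>(X, Xs). X # Xs) ` ({X. X \<subseteq> V \<and> card X = s} \<times> set_families V ss)"
    by (auto simp: set_families_def list_all2_Cons2)
qed (auto simp: set_families_def)

lemma binomial_le_power: "n choose k \<le> n ^ k"
  by (cases "k \<le> n") (auto intro: binomial_le_pow simp: binomial_eq_0)

lemma finite_set_families: "finite V \<Longrightarrow> finite (set_families V ss)"
  by (induction ss) (auto simp: set_families_Cons)

lemma card_set_families_le:
  assumes "finite V"
  shows "card (set_families V ss) \<le> card V ^ sum_list ss"
proof (induction ss)
  case (Cons s ss)
  have fin: "finite {X. X \<subseteq> V \<and> card X = s}" using assms by simp
  have "card (set_families V (s # ss)) \<le> card ({X. X \<subseteq> V \<and> card X = s} \<times> set_families V ss)"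
    unfolding set_families_Cons
    by (rule card_image_le) (use fin finite_set_families[OF assms] in auto)
  also have "\<dots> = (card V choose s) * card (set_families V ss)"
    using assms by (simp add: card_cartesian_product n_subsets)
  also have "\<dots> \<le> card V ^ s * card V ^ sum_list ss"
    by (intro mult_mono binomial_le_power Cons) auto
  finally show ?case by (simp add: power_add)
qed simp

lemma card_set_families_through_le:
  assumes V: "finite V" and "list_all2 (\<lambda>x s. 0 < s) xs ss"
  shows "card {Xs \<in> set_families V ss. xs \<in> listset Xs} * card V ^ length ss \<le> card V ^ sum_list ss"
  using assms(2)
proof (induction xs ss rule: list_all2_induct)
  case Nil
  have "{Xs \<in> set_families V []. [] \<in> listset Xs} \<subseteq> {[]}" by auto
  from card_mono[OF _ this] show ?case by simp
next
  case (Cons x xs s ss)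
  let ?n = "card V"
  let ?P = "{X. X \<subseteq> V \<and> card X = s \<and> x \<in> X}" and ?Q = "{Xs \<in> set_families V ss. xs \<in> listset Xs}"
  have finQ: "finite ?Q" using finite_set_families[OF V] by simp
  have "card ?P = card ((\<lambda>X. X - {x}) ` ?P)"
    by (rule card_image[symmetric], rule inj_on_inverseI[where g = "insert x"]) (simp add: insert_absorb)
  also have "\<dots> \<le> card {X. X \<subseteq> V \<and> card X = s - 1}"
    by (rule card_mono) (use V in \<open>auto simp: card_Diff_singleton\<close>)
  also have "\<dots> \<le> ?n ^ (s - 1)" using V by (simp add: n_subsets binomial_le_power)
  finally have P: "card ?P * ?n \<le> ?n ^ (s - 1) * ?n" by simp
  then have P: "card ?P * ?n \<le> ?n ^ s" using Cons by (simp flip: power_Suc2)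
  have "{Xs \<in> set_families V (s # ss). x # xs \<in> listset Xs} = (\<lambda>(X, Xs). X # Xs) ` (?P \<times> ?Q)"
    by (auto simp: set_families_Cons set_Cons_def)
  then have "card {Xs \<in> set_families V (s # ss). x # xs \<in> listset Xs} \<le> card ?P * card ?Q"
    using card_image_le[of "?P \<times> ?Q" "\<lambda>(X, Xs). X # Xs"] V finQ by (simp add: card_cartesian_product)
  then have "card {Xs \<in> set_families V (s # ss). x # xs \<in> listset Xs} * ?n ^ length (s # ss)
      \<le> (card ?P * card ?Q) * ?n ^ length (s # ss)" by (rule mult_right_mono) simp
  also have "\<dots> = (card ?P * ?n) * (card ?Q * ?n ^ length ss)" by (simp add: mult_ac)
  also have "\<dots> \<le> ?n ^ s * ?n ^ sum_list ss" by (intro mult_mono P Cons) auto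
  finally show ?case by (simp add: power_add)
qed

lemma card_set_families_inside_le:
  assumes V: "finite V" and A: "finite A" and ss: "0 \<notin> set ss"
  shows "card {Xs \<in> set_families V ss. listset Xs \<subseteq> A} * card V ^ length ss \<le> card A * card V ^ sum_list ss"
proof -
  let ?A = "{xs\<in>A. length xs = length ss}"
  let ?B = "\<lambda>xs. {Xs \<in> set_families V ss. xs \<in> listset Xs}"
  have "{Xs \<in> set_families V ss. listset Xs \<subseteq> A} \<subseteq> (\<Union>xs\<in>?A. ?B xs)"
  proof safe
    fix Xs assume Xs: "Xs \<in> set_families V ss" and sub: "listset Xs \<subseteq> A"
    then have len: "length Xs = length ss" by (auto simp: set_families_def dest: list_all2_lengthD)
    have ne: "X \<noteq> {}" if "X \<in> set Xs" for X
    proof -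
      from that obtain i where i: "i < length Xs" "X = Xs ! i" by (auto simp: in_set_conv_nth)
      then have "card X = ss ! i" using Xs by (auto simp: set_families_def list_all2_conv_all_nth)
      moreover have "ss ! i \<noteq> 0" using ss i len by (metis nth_mem)
      ultimately show ?thesis by auto
    qed
    have "map (\<lambda>X. SOME x. x \<in> X) Xs \<in> listset Xs"
      using ne by (auto simp: mem_listset_iff list_all2_conv_all_nth some_in_eq)
    then show "Xs \<in> (\<Union>xs\<in>?A. ?B xs)" using sub Xs len
      by (intro UN_I[of "map (\<lambda>X. SOME x. x \<in> X) Xs"]) auto
  qed
  then have "card {Xs \<in> set_families V ss. listset Xs \<subseteq> A} \<le> card (\<Union>xs\<in>?A. ?B xs)"
    by (rule card_mono[rotated]) (use A V in \<open>auto intro: finite_subset[OF _ finite_set_families]\<close>)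
  also have "\<dots> \<le> (\<Sum>xs\<in>?A. card (?B xs))" by (rule card_UN_le) (use A in auto)
  finally have "card {Xs \<in> set_families V ss. listset Xs \<subseteq> A} * card V ^ length ss
     \<le> (\<Sum>xs\<in>?A. card (?B xs)) * card V ^ length ss" by simp
  also have "\<dots> = (\<Sum>xs\<in>?A. card (?B xs) * card V ^ length ss)" by (rule sum_distrib_right)
  also have "\<dots> \<le> (\<Sum>xs\<in>?A. card V ^ sum_list ss)"
  proof (rule sum_mono)
    fix xs assume "xs \<in> ?A"
    then show "card (?B xs) * card V ^ length ss \<le> card V ^ sum_list ss"
      using ss by (intro card_set_families_through_le[OF V])
        (auto simp: list_all2_conv_all_nth in_set_conv_nth intro!: gr0I)
  qed
  also have "\<dots> \<le> card A * card V ^ sum_list ss" using A by (simp add: card_mono)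
  finally show ?thesis .
qed

lemma card_blowups_Cons_1_le:
  assumes V: "finite V" and A: "finite A" and ss: "0 \<notin> set ss"
    and T: "\<And>x xs. x # xs \<in> T \<Longrightarrow> xs \<in> A"
    and few: "\<And>Xs. Xs \<in> set_families V ss \<Longrightarrow> card {x\<in>V. \<forall>xs\<in>listset Xs. x # xs \<in> T} \<le> q"
  shows "card (blowups V T (1 # ss)) * card V ^ length ss \<le> q * card A * card V ^ sum_list ss"
proof -
  let ?B = "{Xs \<in> set_families V ss. listset Xs \<subseteq> A}"
  let ?N = "\<lambda>Xs. {x\<in>V. \<forall>xs\<in>listset Xs. x # xs \<in> T}"
  have finB: "finite ?B" using finite_set_families[OF V] by simp
  have "blowups V T (1 # ss) \<subseteq> (\<lambda>(Xs, x). {x} # Xs) ` (SIGMA Xs:?B. ?N Xs)"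
    using T by (fastforce simp: blowups_def set_families_Cons set_Cons_def card_1_singleton_iff image_iff)
  then have "card (blowups V T (1 # ss)) \<le> card (SIGMA Xs:?B. ?N Xs)"
    by (rule surj_card_le[rotated]) (use V finB in auto)
  also have "\<dots> = (\<Sum>Xs\<in>?B. card (?N Xs))" by (rule card_SigmaI) (use V finB in auto)
  also have "\<dots> \<le> (\<Sum>Xs\<in>?B. q)" by (rule sum_mono) (use few in auto)
  finally have "card (blowups V T (1 # ss)) \<le> q * card ?B" by (simp add: mult.commute)
  then have "card (blowups V T (1 # ss)) * card V ^ length ss \<le> q * (card ?B * card V ^ length ss)"
    by (simp flip: mult.assoc)
  also have "\<dots> \<le> q * (card A * card V ^ sum_list ss)"
    by (intro mult_left_mono card_set_families_inside_le V A ss) auto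
  finally show ?thesis by (simp add: mult.assoc)
qed

lemma card_blowups:
  assumes V: "finite V"
  shows "card (blowups V T (pre @ s # post)) =
    (\<Sum>(Ys, Zs)\<in>set_families V pre \<times> set_families V post.
       card {x\<in>V. listset (Ys @ {x} # Zs) \<subseteq> T} choose s)"
proof -
  let ?I = "set_families V pre \<times> set_families V post"
  let ?N = "\<lambda>P. {x\<in>V. listset (fst P @ {x} # snd P) \<subseteq> T}"
  let ?S = "SIGMA P:?I. {X. X \<subseteq> ?N P \<and> card X = s}"
  let ?f = "\<lambda>(P, X). fst P @ X # snd P"
  have fin: "finite ?I" using finite_set_families[OF V] by auto
  have inj: "inj_on ?f ?S"
  proof (rule inj_onI)
    fix p q assume pq: "p \<in> ?S" "q \<in> ?S" and eq: "?f p = ?f q"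
    obtain Ys Zs X Ys' Zs' X' where p: "p = ((Ys, Zs), X)" and q: "q = ((Ys', Zs'), X')"
      by (metis prod.exhaust)
    have "length Ys = length Ys'"
      using pq by (auto simp: p q set_families_def dest!: list_all2_lengthD)
    then show "p = q" using eq by (simp add: p q)
  qed
  have img: "?f ` ?S = blowups V T (pre @ s # post)"
  proof -
    have "Ys @ X # Zs \<in> blowups V T (pre @ s # post) \<longleftrightarrow> X \<subseteq> ?N (Ys, Zs) \<and> card X = s"
      if "Ys \<in> set_families V pre" "Zs \<in> set_families V post" for Ys X Zs
    proof -
      have "length Ys = length pre" using that by (auto simp: set_families_def dest: list_all2_lengthD)
      then have "Ys @ X # Zs \<in> set_families V (pre @ s # post) \<longleftrightarrow> X \<subseteq> V \<and> card X = s"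
        using that by (auto simp: set_families_def list_all2_append)
      moreover have "listset (Ys @ X # Zs) \<subseteq> T \<longleftrightarrow> (\<forall>x\<in>X. listset (Ys @ {x} # Zs) \<subseteq> T)"
        by (subst listset_append_Cons) blast
      ultimately show ?thesis unfolding blowups_def by auto
    qed
    note mem_iff = this
    have "\<exists>Ys X Zs. Xs = Ys @ X # Zs \<and> Ys \<in> set_families V pre \<and> Zs \<in> set_families V post"
      if "Xs \<in> blowups V T (pre @ s # post)" for Xs
    proof -
      have "list_all2 (\<lambda>X s. X \<subseteq> V \<and> card X = s) Xs (pre @ s # post)"
        using that by (simp add: blowups_def set_families_def)
      then show ?thesis
        unfolding set_families_def list_all2_append2 list_all2_Cons2 by blast
    qed
    note decompose = this
    show ?thesis
    proof (intro equalityI subsetI)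
      fix Xs assume "Xs \<in> ?f ` ?S"
      then obtain Ys Zs X where "Xs = Ys @ X # Zs" "Ys \<in> set_families V pre" "Zs \<in> set_families V post"
        "X \<subseteq> ?N (Ys, Zs)" "card X = s" by fastforce
      then show "Xs \<in> blowups V T (pre @ s # post)" using mem_iff by blast
    next
      fix Xs assume Xs: "Xs \<in> blowups V T (pre @ s # post)"
      from decompose[OF this] obtain Ys X Zs
        where eq: "Xs = Ys @ X # Zs" and m: "Ys \<in> set_families V pre" "Zs \<in> set_families V post"
        by blast
      have "X \<subseteq> ?N (Ys, Zs) \<and> card X = s" using mem_iff[OF m] Xs eq by blast
      then have "((Ys, Zs), X) \<in> ?S" using m by simp
      then show "Xs \<in> ?f ` ?S" by (rule rev_image_eqI) (simp add: eq)
    qed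
  qed
  have "card (blowups V T (pre @ s # post)) = card ?S"
    using card_image[OF inj] unfolding img .
  also have "\<dots> = (\<Sum>P\<in>?I. card {X. X \<subseteq> ?N P \<and> card X = s})"
    by (rule card_SigmaI[OF fin]) (simp add: V)
  also have "\<dots> = (\<Sum>P\<in>?I. card (?N P) choose s)"
    by (rule sum.cong[OF refl], rule n_subsets) (simp add: V)
  finally show ?thesis by (simp add: case_prod_unfold)
qed

lemma lower_bound_pos:
  fixes b :: real
  assumes "finite V" "V \<noteq> {}" "1 / (card V)\<^sup>2 \<le> b"
  shows "0 < b"
proof -
  have "0 < 1 / real ((card V)\<^sup>2)" using assms by (simp add: card_gt_0_iff)
  then show ?thesis using assms by linarith
qed

lemma power_le_binomial: "real n ^ k \<le> real k ^ k * (1 + real (n choose k))"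
proof (cases "k \<le> n \<and> k > 0")
  case True
  then have "(real n / real k) ^ k \<le> real (n choose k)" by (intro binomial_ge_n_over_k_pow_k) simp
  then have "real n ^ k \<le> real k ^ k * real (n choose k)"
    using True by (simp add: power_divide field_simps)
  then show ?thesis by (simp add: algebra_simps add_increasing)
next
  case False
  then have "real n ^ k \<le> real k ^ k" by (cases "k = 0") (auto intro: power_mono)
  then show ?thesis by (simp add: algebra_simps add_increasing2)
qed

text \<open>The additive constant in \<open>power_le_binomial\<close> costs a relative error \<open>n\<^sup>-\<^sup>s\<close>, which
  \<open>n\<^sup>-\<^sup>2 \<le> \<theta>\<close> absorbs if \<open>s \<ge> 2\<close>; there is no error for \<open>s = 1\<close>. The pointwise bound
  \<open>N \<le> t + N\<^sup>s / t\<^sup>s\<^sup>-\<^sup>1\<close> with the optimal \<open>t\<close> replaces the power mean inequality.\<close>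

lemma card_blowups_step:
  fixes \<theta> :: real
  assumes V: "finite V" "V \<noteq> {}" and s: "s \<ge> 1" and \<theta>: "1 / (card V)\<^sup>2 \<le> \<theta>"
    and le: "card (blowups V T (pre @ s # post)) \<le> \<theta> * real (card V) ^ sum_list (pre @ s # post)"
  shows "card (blowups V T (pre @ 1 # post))
    \<le> (1 + 2 * real s ^ s) * \<theta> powr (1 / s) * real (card V) ^ sum_list (pre @ 1 # post)"
proof -
  let ?n = "real (card V)"
  have n: "?n \<ge> 1" using V by (simp add: Suc_le_eq card_gt_0_iff)
  have \<theta>0: "\<theta> > 0" using V \<theta> by (rule lower_bound_pos)
  show ?thesis
  proof (cases "s = 1")
    case True
    have "1 * (\<theta> * ?n ^ sum_list (pre @ s # post)) \<le> 3 * (\<theta> * ?n ^ sum_list (pre @ s # post))"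
      using \<theta>0 by (intro mult_right_mono) auto
    then show ?thesis using le True \<theta>0 by simp
  next
    case False
    then have s2: "s \<ge> 2" using s by simp
    let ?I = "set_families V pre \<times> set_families V post"
    define N where "N P = real (card {x\<in>V. listset (fst P @ {x} # snd P) \<subseteq> T})" for P
    define m where "m = ?n ^ (sum_list pre + sum_list post)"
    define t where "t = ?n * \<theta> powr (1 / s)"
    have t0: "t > 0" using n \<theta>0 by (simp add: t_def)
    have m0: "m > 0" using n by (simp add: m_def)
    have ts: "t ^ s = \<theta> * ?n ^ s"
      using \<theta>0 s by (simp add: t_def power_mult_distrib powr_power)
    have "card ?I \<le> card V ^ (sum_list pre + sum_list post)"
      unfolding card_cartesian_product power_add
      by (intro mult_mono card_set_families_le V) auto
    then have I: "card ?I \<le> m" unfolding m_def by (metis of_nat_le_iff of_nat_power)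
    have b: "(\<Sum>P\<in>?I. real (card {x\<in>V. listset (fst P @ {x} # snd P) \<subseteq> T} choose s)) \<le> \<theta> * ?n ^ s * m"
      using le unfolding card_blowups[OF V(1)] by (simp add: case_prod_unfold m_def power_add mult_ac)
    have "?n\<^sup>2 \<le> ?n ^ s" using n s2 by (rule power_increasing[rotated])
    then have "1 \<le> \<theta> * ?n ^ s"
    proof -
      have "1 \<le> \<theta> * ?n\<^sup>2" using \<theta> n by (simp add: field_simps)
      also have "\<dots> \<le> \<theta> * ?n ^ s" using \<open>?n\<^sup>2 \<le> ?n ^ s\<close> \<theta>0 by simp
      finally show ?thesis .
    qed
    then have Im: "card ?I \<le> \<theta> * ?n ^ s * m" 
      using I mult_right_mono[of 1 "\<theta> * ?n ^ s" m] m0 by linarith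
    have "N P \<le> t + N P ^ s * (t / t ^ s)" for P
    proof (cases "N P \<le> t")
      case True
      then show ?thesis using t0 by (simp add: N_def add_increasing2)
    next
      case False
      obtain k where k: "s = Suc k" using s by (cases s) auto
      have "t ^ k \<le> N P ^ k" using False t0 by (intro power_mono) auto
      then have "N P * t ^ k \<le> N P * N P ^ k" using False t0 by (intro mult_left_mono) auto
      then show ?thesis using t0 k by (simp add: field_simps add_increasing)
    qed
    then have "(\<Sum>P\<in>?I. N P) \<le> (\<Sum>P\<in>?I. t + N P ^ s * (t / t ^ s))" by (rule sum_mono)
    also have "\<dots> = card ?I * t + (\<Sum>P\<in>?I. N P ^ s) * (t / t ^ s)"
      by (simp only: sum.distrib sum_constant sum_distrib_right)
    also have "\<dots> \<le> m * t + (s ^ s * (2 * (\<theta> * ?n ^ s * m))) * (t / t ^ s)"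
    proof (intro add_mono mult_right_mono I)
      have "(\<Sum>P\<in>?I. N P ^ s) \<le>
          (\<Sum>P\<in>?I. real s ^ s * (1 + real (card {x\<in>V. listset (fst P @ {x} # snd P) \<subseteq> T} choose s)))"
        unfolding N_def by (intro sum_mono power_le_binomial)
      also have "\<dots> = real s ^ s * (card ?I
          + (\<Sum>P\<in>?I. real (card {x\<in>V. listset (fst P @ {x} # snd P) \<subseteq> T} choose s)))"
        by (simp add: sum.distrib flip: sum_distrib_left)
      also have "\<dots> \<le> real s ^ s * (2 * (\<theta> * ?n ^ s * m))"
        using b Im by (intro mult_left_mono) auto
      finally show "(\<Sum>P\<in>?I. N P ^ s) \<le> s ^ s * (2 * (\<theta> * ?n ^ s * m))" by simp
    qed (use t0 in auto)
    also have "\<dots> = (1 + 2 * real s ^ s) * (m * t)"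
      unfolding ts using \<theta>0 n by (simp add: field_simps)
    finally show ?thesis
      unfolding card_blowups[OF V(1)] by (simp add: N_def case_prod_unfold m_def t_def power_add mult_ac)
  qed
qed

lemma card_blowups_iterate:
  assumes "0 \<notin> set ss"
  shows "\<exists>C\<ge>1. \<forall>(V :: 'a set) T pre (\<beta> :: real). finite V \<longrightarrow> V \<noteq> {} \<longrightarrow> 1 / (card V)\<^sup>2 \<le> \<beta> \<longrightarrow> \<beta> \<le> 1 \<longrightarrow>
      card (blowups V T (pre @ ss)) \<le> \<beta> * real (card V) ^ sum_list (pre @ ss) \<longrightarrow>
      card (blowups V T (pre @ replicate (length ss) 1))
        \<le> C * \<beta> powr (1 / real (prod_list ss)) * real (card V) ^ (sum_list pre + length ss)"
  using assms
proof (induction ss)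
  case Nil
  show ?case
    by (intro exI[of _ 1]) (auto intro: order_trans[OF _ mult_right_mono[OF abs_ge_self]])
next
  case (Cons s ss)
  then obtain C :: real where C1: "C \<ge> 1" and C: "\<And>(V :: 'a set) T pre (\<beta> :: real). finite V \<Longrightarrow> V \<noteq> {} \<Longrightarrow>
    1 / (card V)\<^sup>2 \<le> \<beta> \<Longrightarrow> \<beta> \<le> 1 \<Longrightarrow>
    card (blowups V T (pre @ ss)) \<le> \<beta> * real (card V) ^ sum_list (pre @ ss) \<Longrightarrow>
    card (blowups V T (pre @ replicate (length ss) 1))
      \<le> C * \<beta> powr (1 / real (prod_list ss)) * real (card V) ^ (sum_list pre + length ss)" by auto
  let ?q = "prod_list ss"
  have s: "s \<ge> 1" using Cons.prems by simp
  have "?q \<noteq> 0" using Cons.prems by (simp add: prod_list_zero_iff)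
  then have q: "?q \<ge> 1" by linarith
  define C' where "C' = (1 + 2 * real s ^ s) * C powr (1 / s)"
  have "1 \<le> C powr (1 / s)" using C1 by (simp add: ge_one_powr_ge_zero)
  then have "1 * 1 \<le> C'" unfolding C'_def by (rule mult_mono[rotated]) auto
  moreover have "card (blowups V T (pre @ replicate (length (s # ss)) 1))
      \<le> C' * \<beta> powr (1 / real (prod_list (s # ss))) * real (card V) ^ (sum_list pre + length (s # ss))"
    if V: "finite V" "V \<noteq> {}" and \<beta>: "1 / (card V)\<^sup>2 \<le> \<beta>" "\<beta> \<le> 1"
      and le: "card (blowups V T (pre @ s # ss)) \<le> \<beta> * real (card V) ^ sum_list (pre @ s # ss)"
    for V :: "'a set" and T pre and \<beta> :: real
  proof -
    let ?\<theta> = "C * \<beta> powr (1 / ?q)"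
    have \<beta>0: "\<beta> > 0"
      using V \<beta>(1) by (rule lower_bound_pos)
    have IH: "card (blowups V T ((pre @ [s]) @ replicate (length ss) 1))
        \<le> ?\<theta> * real (card V) ^ (sum_list (pre @ [s]) + length ss)"
      by (rule C[OF V \<beta>]) (use le in simp)
    have "\<beta> = \<beta> powr 1" using \<beta>0 by simp
    also have "\<dots> \<le> \<beta> powr (1 / ?q)" using \<beta> \<beta>0 q by (intro powr_mono') auto
    also have "\<dots> \<le> ?\<theta>" using C1 by (simp add: mult_le_cancel_right1)
    finally have "1 / (card V)\<^sup>2 \<le> ?\<theta>" using \<beta> by linarith
    then have "card (blowups V T (pre @ 1 # replicate (length ss) 1))
      \<le> (1 + 2 * real s ^ s) * ?\<theta> powr (1 / s) * real (card V) ^ sum_list (pre @ 1 # replicate (length ss) 1)"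
      using IH by (intro card_blowups_step[OF V s]) (auto simp: sum_list_replicate add.assoc)
    also have "?\<theta> powr (1 / s) = C powr (1 / s) * \<beta> powr (1 / real (prod_list (s # ss)))"
      using C1 \<beta>0 by (simp add: powr_mult powr_powr mult.commute)
    finally show ?thesis by (simp add: C'_def sum_list_replicate mult_ac)
  qed
  ultimately show ?case by (intro exI[of _ C']) auto
qed

lemma card_le_card_blowups:
  assumes V: "finite V" and T: "T \<subseteq> {xs. set xs \<subseteq> V \<and> length xs = k}"
  shows "card T \<le> card (blowups V T (replicate k 1))"
proof -
  have sing: "listset (map (\<lambda>x. {x}) xs) = {xs}" for xs :: "'a list"
    by (induction xs) (auto simp: set_Cons_def)
  have "map (\<lambda>x. {x}) xs \<in> blowups V T (replicate k 1)" if "xs \<in> T" for xs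
  proof -
    have "xs ! i \<in> V" if "i < length xs" for i using T \<open>xs \<in> T\<close> nth_mem[OF that] by blast
    then show ?thesis
      using T that by (auto simp: blowups_def set_families_def sing list_all2_conv_all_nth)
  qed
  then have "map (\<lambda>x. {x}) ` T \<subseteq> blowups V T (replicate k 1)" by auto
  moreover have "finite (blowups V T (replicate k 1))"
    using finite_set_families[OF V] by (simp add: blowups_def)
  moreover have "inj_on (map (\<lambda>x. {x})) T" by (auto simp: inj_on_def)
  ultimately show ?thesis by (metis card_image card_mono)
qed

lemma card_le_if_base_few:
  assumes ss: "0 \<notin> set ss"
  shows "\<exists>C\<ge>1. \<forall>(V :: 'a set) T A q (\<delta> :: real). finite V \<longrightarrow> V \<noteq> {} \<longrightarrow>
      T \<subseteq> {xs. set xs \<subseteq> V \<and> length xs = Suc (length ss)} \<longrightarrow> finite A \<longrightarrow> (\<forall>x xs. x # xs \<in> T \<longrightarrow> xs \<in> A) \<longrightarrow>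
      (\<forall>Xs\<in>set_families V ss. card {x\<in>V. \<forall>xs\<in>listset Xs. x # xs \<in> T} \<le> q) \<longrightarrow>
      card A \<le> \<delta> * real (card V) ^ length ss \<longrightarrow> 1 / (card V)\<^sup>2 \<le> q * \<delta> / card V \<longrightarrow> q * \<delta> / card V \<le> 1 \<longrightarrow>
      card T \<le> C * (q * \<delta> / card V) powr (1 / real (prod_list ss)) * real (card V) ^ Suc (length ss)"
proof -
  obtain C :: real where C1: "C \<ge> 1" and C: "\<And>(V :: 'a set) T pre (\<beta> :: real). finite V \<Longrightarrow> V \<noteq> {} \<Longrightarrow>
      1 / (card V)\<^sup>2 \<le> \<beta> \<Longrightarrow> \<beta> \<le> 1 \<Longrightarrow>
      card (blowups V T (pre @ ss)) \<le> \<beta> * real (card V) ^ sum_list (pre @ ss) \<Longrightarrow>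
      card (blowups V T (pre @ replicate (length ss) 1))
        \<le> C * \<beta> powr (1 / real (prod_list ss)) * real (card V) ^ (sum_list pre + length ss)"
    using card_blowups_iterate[where ss = ss and 'a = 'a, OF ss] by auto
  have "card T \<le> C * (q * \<delta> / card V) powr (1 / real (prod_list ss)) * real (card V) ^ Suc (length ss)"
    if V: "finite V" "V \<noteq> {}" and T: "T \<subseteq> {xs. set xs \<subseteq> V \<and> length xs = Suc (length ss)}"
      and A: "finite A" "\<And>x xs. x # xs \<in> T \<Longrightarrow> xs \<in> A"
      and few: "\<And>Xs. Xs \<in> set_families V ss \<Longrightarrow> card {x\<in>V. \<forall>xs\<in>listset Xs. x # xs \<in> T} \<le> q"
      and cA: "card A \<le> \<delta> * real (card V) ^ length ss" and \<beta>: "1 / (card V)\<^sup>2 \<le> q * \<delta> / card V" "q * \<delta> / card V \<le> 1"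
    for V :: "'a set" and T A q and \<delta> :: real
  proof -
    let ?n = "real (card V)" and ?k = "length ss"
    have n: "?n > 0" using V by (simp add: card_gt_0_iff)
    have "card (blowups V T (1 # ss)) * card V ^ ?k \<le> q * card A * card V ^ sum_list ss"
      by (rule card_blowups_Cons_1_le[OF V(1) A(1) ss A(2) few])
    then have "real (card (blowups V T (1 # ss)) * card V ^ ?k) \<le> real (q * card A * card V ^ sum_list ss)"
      by (simp only: of_nat_le_iff)
    also have "\<dots> \<le> q * (\<delta> * ?n ^ ?k) * ?n ^ sum_list ss"
      unfolding of_nat_mult of_nat_power using cA by (intro mult_right_mono mult_left_mono) auto
    also have "\<dots> = q * \<delta> / ?n * ?n ^ sum_list (1 # ss) * ?n ^ ?k" using n by simp
    finally have "card (blowups V T ([1] @ ss)) \<le> q * \<delta> / ?n * ?n ^ sum_list ([1] @ ss)"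
      using n by simp
    then have "card (blowups V T ([1] @ replicate ?k 1))
        \<le> C * (q * \<delta> / ?n) powr (1 / real (prod_list ss)) * ?n ^ (sum_list [1] + ?k)"
      by (rule C[OF V \<beta>])
    moreover have "card T \<le> card (blowups V T ([1] @ replicate ?k 1))"
      using card_le_card_blowups[OF V(1) T] by simp
    ultimately show ?thesis by simp
  qed
  then show ?thesis using C1 by (intro exI[of _ C]) simp
qed

section \<open>Counting cliques\<close>

definition cliques :: "'a set \<Rightarrow> ('a \<times> 'a) set \<Rightarrow> nat \<Rightarrow> 'a list set" where
  "cliques V R r = {xs. set xs \<subseteq> V \<and> length xs = r \<and> sorted_wrt (\<lambda>x y. (x, y) \<in> R) xs}"

definition link :: "'a set \<Rightarrow> ('a \<times> 'a) set \<Rightarrow> 'a list \<Rightarrow> ('a \<times> 'a) set" where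
  "link V R w = {(x, y). x # y # w \<in> cliques V R (Suc (Suc (length w)))}"

lemma triangles_link:
  "(x, y, z) \<in> triangles V (link V R w) \<longleftrightarrow> x # y # z # w \<in> cliques V R (Suc (Suc (Suc (length w))))"
  by (auto simp: triangles_def link_def cliques_def)

lemma finite_cliques: "finite V \<Longrightarrow> finite (cliques V R r)"
  by (rule finite_subset[OF _ finite_lists_length_eq[of V r]]) (auto simp: cliques_def)

text \<open>For all but few \<open>w\<close>, the link of \<open>w\<close> has few triangles, and the removal lemma yields
  a sparse set of edges meeting all of them. Together with \<open>w\<close> these edges form the set \<open>A\<close>;
  a permutation of the first three vertices moves every clique to one whose tail lies in \<open>A\<close>.\<close>

lemma card_cliques_le_small:
  fixes V :: "'a set" and \<gamma> \<delta> :: real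
  assumes V: "finite V" and R: "sym R" and \<gamma>: "\<gamma> > 0" and \<delta>: "\<delta> \<ge> 0"
    and removal: "\<And>R. card (triangles V R) < \<gamma> * real (card V) ^ 3 \<Longrightarrow>
       \<exists>E \<subseteq> V \<times> V. card E \<le> \<delta> * (card V)\<^sup>2 \<and>
         (\<forall>(x, y, z) \<in> triangles V R. (x, y) \<in> E \<or> (y, z) \<in> E \<or> (x, z) \<in> E)"
    and few: "card (cliques V R (m + 3)) \<le> \<delta> * \<gamma> * real (card V) ^ (m + 3)"
  obtains A where "A \<subseteq> {xs. set xs \<subseteq> V \<and> length xs = m + 2}" "card A \<le> 2 * \<delta> * real (card V) ^ (m + 2)"
    "card (cliques V R (m + 3)) \<le> 3 * card {xs \<in> cliques V R (m + 3). tl xs \<in> A}"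
proof -
  let ?n = "real (card V)"
  define W where "W = {w. set w \<subseteq> V \<and> length w = m}"
  have finW: "finite W" and cW: "card W = card V ^ m"
    unfolding W_def using finite_lists_length_eq[OF V] card_lists_length_eq[OF V] by auto
  define bad where "bad = {w\<in>W. \<gamma> * ?n ^ 3 \<le> card (triangles V (link V R w))}"
  have finbad: "finite bad" using finW by (simp add: bad_def)
  have fint: "finite (triangles V S)" for S
    by (rule finite_subset[of _ "V \<times> V \<times> V"]) (use V in \<open>auto simp: triangles_def\<close>)
  have "card bad * (\<gamma> * ?n ^ 3) \<le> (\<Sum>w\<in>bad. real (card (triangles V (link V R w))))"
    using sum_mono[of bad "\<lambda>_. \<gamma> * ?n ^ 3" "\<lambda>w. real (card (triangles V (link V R w)))"]
    by (simp add: bad_def)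
  also have "\<dots> = card (SIGMA w:bad. triangles V (link V R w))"
    using finbad fint by simp
  also have "\<dots> \<le> card (cliques V R (m + 3))"
  proof (intro of_nat_mono card_inj_on_le finite_cliques V)
    show "inj_on (\<lambda>(w, x, y, z). x # y # z # w) (SIGMA w:bad. triangles V (link V R w))"
      by (auto simp: inj_on_def)
    show "(\<lambda>(w, x, y, z). x # y # z # w) ` (SIGMA w:bad. triangles V (link V R w)) \<subseteq> cliques V R (m + 3)"
      by (auto simp: triangles_link bad_def W_def numeral_eq_Suc)
  qed
  also note few
  finally have bad3: "card bad * (\<gamma> * ?n ^ 3) \<le> \<delta> * \<gamma> * ?n ^ (m + 3)" .
  have bad: "card bad * ?n\<^sup>2 \<le> \<delta> * ?n ^ (m + 2)"
  proof (cases "V = {}")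
    case False
    then have "?n > 0" using V by (simp add: card_gt_0_iff)
    moreover have "(card bad * ?n\<^sup>2) * (\<gamma> * ?n) \<le> (\<delta> * ?n ^ (m + 2)) * (\<gamma> * ?n)"
      using bad3 by (simp add: power_add power2_eq_square power3_eq_cube mult_ac)
    ultimately show ?thesis using \<gamma> by (simp add: mult_ac)
  qed simp
  have "\<forall>w\<in>W - bad. \<exists>E \<subseteq> V \<times> V. card E \<le> \<delta> * ?n\<^sup>2 \<and>
         (\<forall>(x, y, z) \<in> triangles V (link V R w). (x, y) \<in> E \<or> (y, z) \<in> E \<or> (x, z) \<in> E)"
    using removal by (auto simp: bad_def not_le)
  then obtain E where E: "\<forall>w\<in>W - bad. E w \<subseteq> V \<times> V \<and> card (E w) \<le> \<delta> * ?n\<^sup>2 \<and>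
         (\<forall>(x, y, z) \<in> triangles V (link V R w). (x, y) \<in> E w \<or> (y, z) \<in> E w \<or> (x, z) \<in> E w)"
    by (rule bchoice[THEN exE])
  define E' where "E' w = (if w \<in> bad then V \<times> V else E w)" for w
  define A where "A = (\<lambda>(w, x, y). x # y # w) ` (SIGMA w:W. E' w)"
  have E'V: "E' w \<subseteq> V \<times> V" if "w \<in> W" for w using E that by (auto simp: E'_def)
  have finE': "finite (E' w)" if "w \<in> W" for w using E'V[OF that] V finite_subset by blast
  have A_sub: "A \<subseteq> {xs. set xs \<subseteq> V \<and> length xs = m + 2}"
    using E'V by (fastforce simp: A_def W_def)
  have "card A \<le> (\<Sum>w\<in>W. card (E' w))"
    unfolding A_def using finW finE' by (intro card_image_le[THEN order_trans]) auto
  also have "real \<dots> \<le> (\<Sum>w\<in>W. \<delta> * ?n\<^sup>2 + (if w \<in> bad then ?n\<^sup>2 else 0))"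
    unfolding of_nat_sum
    by (rule sum_mono) (use E \<delta> in \<open>auto simp: E'_def card_cartesian_product power2_eq_square\<close>)
  also have "\<dots> = ?n ^ m * (\<delta> * ?n\<^sup>2) + card bad * ?n\<^sup>2"
  proof -
    have "bad \<subseteq> W" by (auto simp: bad_def)
    then show ?thesis
      using finW by (simp add: sum.distrib cW sum.If_cases Int_absorb1)
  qed
  also have "?n ^ m * (\<delta> * ?n\<^sup>2) = \<delta> * ?n ^ (m + 2)"
    by (simp add: power_add power2_eq_square mult_ac)
  also have "\<delta> * ?n ^ (m + 2) + card bad * ?n\<^sup>2 \<le> 2 * \<delta> * ?n ^ (m + 2)" using bad by simp
  finally have cA: "card A \<le> 2 * \<delta> * ?n ^ (m + 2)" by simp
  let ?T = "{xs \<in> cliques V R (m + 3). tl xs \<in> A}"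
  let ?f = "\<lambda>xs :: 'a list. xs ! 1 # xs ! 2 # xs ! 0 # drop 3 xs"
  let ?g = "\<lambda>xs :: 'a list. xs ! 1 # xs ! 0 # drop 2 xs"
  have "cliques V R (m + 3) \<subseteq> ?T \<union> ?f ` ?T \<union> ?g ` ?T"
  proof
    fix xs assume xs: "xs \<in> cliques V R (m + 3)"
    then obtain x y z w where eq: "xs = x # y # z # w" and w: "w \<in> W"
      by (auto simp: cliques_def W_def numeral_eq_Suc length_Suc_conv)
    have lw: "length w = m" using w by (simp add: W_def)
    have zxyw: "z # x # y # w \<in> cliques V R (m + 3)" and yxzw: "y # x # z # w \<in> cliques V R (m + 3)"
      using xs R by (auto simp: eq cliques_def dest: symD)
    have "(x, y, z) \<in> triangles V (link V R w)"
      using xs by (simp add: triangles_link eq lw numeral_eq_Suc)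
    then have "(x, y) \<in> E' w \<or> (y, z) \<in> E' w \<or> (x, z) \<in> E' w"
      using E w by (cases "w \<in> bad") (auto simp: E'_def triangles_def)
    then consider "x # y # w \<in> A" | "y # z # w \<in> A" | "x # z # w \<in> A"
      using w by (force simp: A_def)
    then show "xs \<in> ?T \<union> ?f ` ?T \<union> ?g ` ?T"
    proof cases
      case 1
      then have "z # x # y # w \<in> ?T" using zxyw by simp
      then have "?f (z # x # y # w) \<in> ?f ` ?T" by (rule imageI)
      then show ?thesis by (simp add: eq numeral_eq_Suc)
    next
      case 2
      then show ?thesis using xs by (simp add: eq)
    next
      case 3
      then have "y # x # z # w \<in> ?T" using yxzw by simp
      then have "?g (y # x # z # w) \<in> ?g ` ?T" by (rule imageI)
      then show ?thesis by (simp add: eq numeral_eq_Suc)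
    qed
  qed
  moreover have finT: "finite ?T" using finite_cliques[OF V] by simp
  ultimately have "card (cliques V R (m + 3)) \<le> card (?T \<union> ?f ` ?T \<union> ?g ` ?T)"
    by (intro card_mono) auto
  also have "\<dots> \<le> card ?T + card (?f ` ?T) + card (?g ` ?T)"
    by (meson add_le_mono card_Un_le le_trans order_refl)
  also have "\<dots> \<le> 3 * card ?T"
    using card_image_le[OF finT, of ?f] card_image_le[OF finT, of ?g] by linarith
  finally show thesis using that A_sub cA by blast
qed

lemma card_cliques_small_o:
  fixes q :: nat and c :: real
  assumes ss: "0 \<notin> set ss" and len: "length ss \<ge> 2" and q: "q > 0" and c: "c > 0"
  shows "\<forall>\<^sub>F n in sequentially. \<forall>(V :: 'a set) R. finite V \<longrightarrow> card V = n \<longrightarrow> sym R \<longrightarrow>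
    (\<forall>Xs\<in>set_families V ss. card {x\<in>V. \<forall>xs\<in>listset Xs. x # xs \<in> cliques V R (Suc (length ss))} \<le> q) \<longrightarrow>
    card (cliques V R (Suc (length ss))) \<le> c * n powr (Suc (length ss) - 1 / real (prod_list ss))"
proof -
  let ?k = "length ss" and ?p = "real (prod_list ss)"
  obtain m where m: "?k = m + 2" using len by (metis add.commute le_Suc_ex)
  have "prod_list ss \<noteq> 0" using ss by (simp add: prod_list_zero_iff)
  then have p: "?p > 0" by simp
  obtain C :: real where C1: "C \<ge> 1" and C: "\<And>(V :: 'a set) T A q (\<delta> :: real). finite V \<Longrightarrow> V \<noteq> {} \<Longrightarrow>
      T \<subseteq> {xs. set xs \<subseteq> V \<and> length xs = Suc ?k} \<Longrightarrow> finite A \<Longrightarrow> (\<And>x xs. x # xs \<in> T \<Longrightarrow> xs \<in> A) \<Longrightarrow>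
      (\<And>Xs. Xs \<in> set_families V ss \<Longrightarrow> card {x\<in>V. \<forall>xs\<in>listset Xs. x # xs \<in> T} \<le> q) \<Longrightarrow>
      card A \<le> \<delta> * real (card V) ^ ?k \<Longrightarrow> 1 / (card V)\<^sup>2 \<le> q * \<delta> / card V \<Longrightarrow> q * \<delta> / card V \<le> 1 \<Longrightarrow>
      card T \<le> C * (q * \<delta> / card V) powr (1 / ?p) * real (card V) ^ Suc ?k"
    using card_le_if_base_few[where ss = ss and 'a = 'a, OF ss] by auto
  define d where "d = (c / (3 * C)) powr ?p / (2 * q)"
  have d: "d > 0" using c C1 q by (simp add: d_def)
  have qd: "3 * C * (q * (2 * d)) powr (1 / ?p) = c"
    using c C1 q p by (simp add: d_def powr_powr)
  obtain \<gamma> :: real where \<gamma>: "\<gamma> > 0" and removal: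
    "\<And>(V :: 'a set) R. finite V \<Longrightarrow> card (triangles V R) < \<gamma> * real (card V) ^ 3 \<Longrightarrow>
       \<exists>E \<subseteq> V \<times> V. card E \<le> d * (card V)\<^sup>2 \<and>
         (\<forall>(x, y, z) \<in> triangles V R. (x, y) \<in> E \<or> (y, z) \<in> E \<or> (x, z) \<in> E)"
    using triangle_removal[OF d, where 'a = 'a] by blast
  have lim: "(\<lambda>n. a / real n) \<longlonglongrightarrow> 0" for a by (rule lim_const_over_n)
  have "(\<lambda>n. C * (q / real n) powr (1 / ?p)) \<longlonglongrightarrow> C * 0 powr (1 / ?p)"
    by (intro tendsto_mult tendsto_const tendsto_powr' lim) (use p in auto)
  then have "\<forall>\<^sub>F n in sequentially. C * (q / real n) powr (1 / ?p) < d * \<gamma>"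
    by (rule order_tendstoD) (use d \<gamma> p in simp)
  moreover have "\<forall>\<^sub>F n in sequentially. q * (2 * d) / real n < 1" "\<forall>\<^sub>F n in sequentially. q * 1 / real n < 1"
    using order_tendstoD(2)[OF lim] by auto
  moreover have "\<forall>\<^sub>F n in sequentially. real n \<ge> 1 / (q * (2 * d))" "\<forall>\<^sub>F n in sequentially. n \<ge> 1"
    using filterlim_real_sequentially by (auto simp: filterlim_at_top eventually_ge_at_top)
  ultimately show ?thesis
  proof eventually_elim
    case (elim n)
    show ?case
    proof (intro allI impI)
      fix V :: "'a set" and R
      assume V: "finite V" and n: "card V = n" and R: "sym R" and
        few: "\<forall>Xs\<in>set_families V ss. card {x\<in>V. \<forall>xs\<in>listset Xs. x # xs \<in> cliques V R (Suc ?k)} \<le> q"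
      have n0: "real n > 0" "V \<noteq> {}" using elim n by auto
      let ?L = "{xs. set xs \<subseteq> V \<and> length xs = ?k}"
      have finL: "finite ?L" by (rule finite_lists_length_eq[OF V])
      have bound: "card T \<le> C * (q * \<delta> / n) powr (1 / ?p) * real n ^ Suc ?k"
        if T: "T = {xs \<in> cliques V R (Suc ?k). tl xs \<in> A}" and A: "A \<subseteq> ?L"
          and cA: "card A \<le> \<delta> * real n ^ ?k" and \<delta>: "1 / n \<le> q * \<delta>" "q * \<delta> / n \<le> 1" for T A and \<delta> :: real
      proof -
        have "card T \<le> C * (q * \<delta> / card V) powr (1 / ?p) * real (card V) ^ Suc ?k"
        proof (rule C[OF V n0(2), of T A])
          show "T \<subseteq> {xs. set xs \<subseteq> V \<and> length xs = Suc ?k}" by (auto simp: T cliques_def)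
          show "finite A" using A finL finite_subset by blast
          show "card {x\<in>V. \<forall>xs\<in>listset Xs. x # xs \<in> T} \<le> q" if "Xs \<in> set_families V ss" for Xs
          proof -
            have "card {x\<in>V. \<forall>xs\<in>listset Xs. x # xs \<in> T}
                \<le> card {x\<in>V. \<forall>xs\<in>listset Xs. x # xs \<in> cliques V R (Suc ?k)}"
              by (rule card_mono) (use V in \<open>auto simp: T\<close>)
            then show ?thesis using few that by force
          qed
          show "1 / real ((card V)\<^sup>2) \<le> q * \<delta> / card V"
            using \<delta>(1) n0 by (simp add: n power2_eq_square field_simps)
        qed (use T cA \<delta> n in auto)
        then show ?thesis by (simp add: n)
      qed
      have "card (cliques V R (Suc ?k)) \<le> C * (q * (1 :: real) / n) powr (1 / ?p) * real n ^ Suc ?k"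
      proof (rule bound[OF _ order_refl])
        have "tl xs \<in> ?L" if "xs \<in> cliques V R (Suc ?k)" for xs
          using that by (cases xs) (auto simp: cliques_def)
        then show "cliques V R (Suc ?k) = {xs \<in> cliques V R (Suc ?k). tl xs \<in> ?L}" by auto
        show "card ?L \<le> 1 * real n ^ ?k" using card_lists_length_eq[OF V] n by simp
        have "1 / real n \<le> 1" "1 \<le> real q" using elim q by auto
        then show "1 / n \<le> q * (1 :: real)" by linarith
      qed (use elim in simp)
      also have "\<dots> \<le> d * \<gamma> * real n ^ Suc ?k" using elim by (intro mult_right_mono) auto
      finally have few_cl: "card (cliques V R (m + 3)) \<le> d * \<gamma> * real (card V) ^ (m + 3)"
        by (simp add: m n numeral_eq_Suc)
      obtain A where A: "A \<subseteq> {xs. set xs \<subseteq> V \<and> length xs = m + 2}"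
          "card A \<le> 2 * d * real (card V) ^ (m + 2)"
          "card (cliques V R (m + 3)) \<le> 3 * card {xs \<in> cliques V R (m + 3). tl xs \<in> A}"
        using card_cliques_le_small[OF V R \<gamma> less_imp_le[OF d] removal[OF V] few_cl] by blast
      have k3: "Suc ?k = m + 3" using m by simp
      let ?T = "{xs \<in> cliques V R (Suc ?k). tl xs \<in> A}"
      have "1 / real n \<le> q * (2 * d)"
        using elim q d n0 by (simp add: field_simps)
      then have "card ?T \<le> C * (q * (2 * d) / n) powr (1 / ?p) * real n ^ Suc ?k"
        using A elim by (intro bound) (auto simp: m n)
      moreover have "real (card (cliques V R (Suc ?k))) \<le> 3 * card ?T"
        using A(3) unfolding k3 by (metis of_nat_le_iff of_nat_mult of_nat_numeral)
      ultimately have "card (cliques V R (Suc ?k)) \<le> 3 * C * (q * (2 * d) / n) powr (1 / ?p) * real n ^ Suc ?k"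
        by simp
      also have "\<dots> = c * n powr (Suc ?k - 1 / ?p)"
      proof -
        have "(q * (2 * d) / n) powr (1 / ?p) = (q * (2 * d)) powr (1 / ?p) * n powr (- (1 / ?p))"
          using n0 d by (simp add: powr_divide powr_minus field_simps)
        moreover have "real n powr (- (1 / ?p)) * real n ^ Suc ?k = n powr (Suc ?k - 1 / ?p)"
          using n0 by (simp add: powr_diff powr_minus powr_realpow[symmetric] field_simps
              del: power_Suc of_nat_Suc)
        ultimately show ?thesis by (simp only: qd[symmetric] mult.assoc)
      qed
      finally show "card (cliques V R (Suc ?k)) \<le> c * n powr (Suc ?k - 1 / ?p)" .
    qed
  qed
qed

section \<open>Graphs without a complete multipartite subgraph\<close>

lemma card_copies_complete_le:
  fixes G :: "'b pair_pre_digraph"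
  assumes "pair_graph G"
  shows "card (copies (complete_graph r) G) \<le> card (cliques (pverts G) (parcs G) r)"
proof -
  interpret pair_graph G by fact
  let ?h = "\<lambda>xs. \<lparr>pverts = set xs, parcs = {(u, v). u \<in> set xs \<and> v \<in> set xs \<and> u \<noteq> v}\<rparr>"
  have "copies (complete_graph r) G \<subseteq> ?h ` cliques (pverts G) (parcs G) r"
  proof
    fix F assume F: "F \<in> copies (complete_graph r) G"
    let ?K = "complete_graph r"
    have sub: "pverts F \<subseteq> pverts G" "parcs F \<subseteq> parcs G"
      using F by (auto simp: copies_def subgraph_def)
    obtain f where f: "pre_digraph.digraph_isomorphism (with_proj ?K) f" "with_proj F = app_iso f (with_proj ?K)"
      using F by (auto simp: copies_def digraph_iso_def)
    let ?g = "iso_verts f"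
    have inj: "inj_on ?g {..<r}"
      using f(1) by (simp add: pre_digraph.digraph_isomorphism_def complete_graph_def)
    have vF: "pverts F = ?g ` {..<r}"
      using arg_cong[OF f(2), of verts] by (simp add: complete_graph_def)
    have tl: "iso_tail f = fst" "iso_head f = snd"
      using arg_cong[OF f(2), of tail] arg_cong[OF f(2), of head] by simp_all
    have "iso_arcs f a = (?g (fst a), ?g (snd a))" if "a \<in> parcs ?K" for a
      using f(1) that by (simp add: pre_digraph.digraph_isomorphism_def tl prod_eq_iff)
    then have aF: "parcs F = (\<lambda>a. (?g (fst a), ?g (snd a))) ` parcs ?K"
      using arg_cong[OF f(2), of arcs] by (simp cong: image_cong)
    let ?xs = "map ?g [0..<r]"
    have arc: "(?g i, ?g j) \<in> parcs F" if "i < r" "j < r" "i \<noteq> j" for i j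
      using that unfolding aF by (intro rev_image_eqI[of "(i, j)"]) (auto simp: complete_graph_def)
    have "F = ?h ?xs"
    proof (rule pair_pre_digraph.equality)
      show "pverts F = pverts (?h ?xs)" by (simp add: vF atLeast0LessThan)
      show "parcs F = parcs (?h ?xs)"
      proof (intro equalityI subsetI)
        fix a assume "a \<in> parcs F"
        then show "a \<in> parcs (?h ?xs)" using inj by (auto simp: aF complete_graph_def inj_on_def)
      next
        fix a assume "a \<in> parcs (?h ?xs)"
        then show "a \<in> parcs F" by (auto intro!: arc)
      qed
    qed simp
    moreover have "?xs \<in> cliques (pverts G) (parcs G) r"
      using sub vF arc by (auto simp: cliques_def sorted_wrt_map sorted_wrt_iff_nth_less)
    ultimately show "F \<in> ?h ` cliques (pverts G) (parcs G) r" by blast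
  qed
  then have "card (copies (complete_graph r) G) \<le> card (?h ` cliques (pverts G) (parcs G) r)"
    by (intro card_mono finite_imageI finite_cliques pair_finite_verts)
  also have "\<dots> \<le> card (cliques (pverts G) (parcs G) r)"
    by (intro card_image_le finite_cliques pair_finite_verts)
  finally show ?thesis .
qed

lemma complete_multipartite_copy:
  fixes G :: "'b pair_pre_digraph"
  assumes G: "pair_graph G"
    and X: "\<And>i. i \<in> {1..r} \<Longrightarrow> X i \<subseteq> pverts G \<and> card (X i) = s i"
    and adj: "\<And>i j x y. i \<in> {1..r} \<Longrightarrow> j \<in> {1..r} \<Longrightarrow> i \<noteq> j \<Longrightarrow> x \<in> X i \<Longrightarrow> y \<in> X j \<Longrightarrow> (x, y) \<in> parcs G"
  shows "\<not> graph_free (complete_multipartite_graph r s) G"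
proof -
  interpret pair_graph G by fact
  let ?H = "complete_multipartite_graph r s"
  have "\<forall>i\<in>{1..r}. \<exists>h. bij_betw h {..<s i} (X i)"
  proof
    fix i assume "i \<in> {1..r}"
    then have "finite (X i)" "card (X i) = s i" using X pair_finite_verts finite_subset by blast+
    then show "\<exists>h. bij_betw h {..<s i} (X i)"
      using ex_bij_betw_nat_finite by (metis atLeast0LessThan)
  qed
  then obtain h where h: "\<And>i. i \<in> {1..r} \<Longrightarrow> bij_betw (h i) {..<s i} (X i)" by metis
  define g where "g = (\<lambda>(i, j). h i j)"
  have V: "pverts ?H = (SIGMA i:{1..r}. {..<s i})" by (simp add: complete_multipartite_graph_def Let_def)
  have E: "parcs ?H = {(u, v). u \<in> pverts ?H \<and> v \<in> pverts ?H \<and> fst u \<noteq> fst v}"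
    by (simp add: complete_multipartite_graph_def Let_def)
  have gX: "g u \<in> X (fst u)" "fst u \<in> {1..r}" if "u \<in> pverts ?H" for u
    using that by (auto simp: V g_def intro!: bij_betw_apply[OF h])
  have gadj: "(g u, g v) \<in> parcs G" if "u \<in> pverts ?H" "v \<in> pverts ?H" "fst u \<noteq> fst v" for u v
    using adj gX that by blast
  have inj: "inj_on g (pverts ?H)"
  proof (rule inj_onI)
    fix u v assume uv: "u \<in> pverts ?H" "v \<in> pverts ?H" and eq: "g u = g v"
    have fst: "fst u = fst v" using gadj[OF uv] pair_no_loops eq by fastforce
    then have "inj_on (h (fst u)) {..<s (fst u)}" using h gX(2)[OF uv(1)] by (simp add: bij_betw_def)
    then have "snd u = snd v" using uv eq fst by (auto simp: V g_def case_prod_unfold inj_on_def)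
    then show "u = v" using fst by (simp add: prod_eq_iff)
  qed
  let ?F = "\<lparr>pverts = g ` pverts ?H, parcs = map_prod g g ` parcs ?H\<rparr>"
  let ?f = "\<lparr>iso_verts = g, iso_arcs = map_prod g g, iso_head = snd, iso_tail = fst\<rparr>"
  interpret H: pair_graph ?H by (rule pair_graph_complete_multipartite_graph)
  have "with_proj ?F = app_iso ?f (with_proj ?H)"
    by (simp add: with_proj_def app_iso_def)
  moreover have "pre_digraph.digraph_isomorphism (with_proj ?H) ?f"
  proof -
    have "inj_on (map_prod g g) (parcs ?H)"
      by (rule inj_on_subset[OF map_prod_inj_on[OF inj inj]]) (auto simp: E)
    then show ?thesis
      using inj H.wf_digraph by (simp add: pre_digraph.digraph_isomorphism_def)
  qed
  ultimately have "digraph_iso (with_proj ?H) (with_proj ?F)" unfolding digraph_iso_def by blast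
  moreover have "subgraph (with_proj ?F) (with_proj G)"
  proof -
    have "wf_digraph (with_proj ?F)" by unfold_locales (auto simp: E)
    moreover have "g ` pverts ?H \<subseteq> pverts G" using gX X by blast
    moreover have "map_prod g g ` parcs ?H \<subseteq> parcs G" using gadj by (auto simp: E)
    ultimately show ?thesis
      using wf_digraph by (simp add: subgraph_def compatible_def)
  qed
  ultimately have "?F \<in> copies ?H G" by (simp add: copies_def)
  then show ?thesis by (auto simp: graph_free_def)
qed

lemma card_common_extension_le:
  fixes G :: "'b pair_pre_digraph"
  assumes G: "pair_graph G" and free: "graph_free (complete_multipartite_graph (Suc k) s) G"
    and s: "\<And>i. i \<in> {1..Suc k} \<Longrightarrow> 0 < s i" and Xs: "Xs \<in> set_families (pverts G) (map s [1..<Suc k])"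
  shows "card {x\<in>pverts G. \<forall>xs\<in>listset Xs. x # xs \<in> cliques (pverts G) (parcs G) (Suc k)} \<le> s (Suc k)"
    (is "card ?N \<le> _")
proof (rule ccontr)
  interpret pair_graph G by fact
  assume "\<not> card ?N \<le> s (Suc k)"
  then obtain Z where Z: "Z \<subseteq> ?N" "card Z = s (Suc k)"
    by (metis (lifting) nat_le_linear obtain_subset_with_card_n)
  have len: "length Xs = k" using Xs by (auto simp: set_families_def dest: list_all2_lengthD)
  have nth: "Xs ! i \<subseteq> pverts G" "card (Xs ! i) = s (Suc i)" if "i < k" for i
    using Xs that by (auto simp: set_families_def list_all2_conv_all_nth simp del: upt_Suc)
  have ne: "Xs ! i \<noteq> {}" if "i < k" for i using nth(2)[OF that] s[of "Suc i"] that by auto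
  have transversal: "\<exists>xs\<in>listset Xs. xs ! i = x \<and> xs ! j = y"
    if "i < k" "j < k" "x \<in> Xs ! i" "y \<in> Xs ! j" "i \<noteq> j \<or> x = y" for i j x y
    using that ne len
    by (intro bexI[of _ "map (\<lambda>l. if l = i then x else if l = j then y else SOME u. u \<in> Xs ! l) [0..<k]"])
      (auto simp: mem_listset_iff list_all2_conv_all_nth some_in_eq)
  have clique: "z # xs \<in> cliques (pverts G) (parcs G) (Suc k)" if "z \<in> Z" "xs \<in> listset Xs" for z xs
    using Z that by auto
  have "Z \<noteq> {}" using Z s[of "Suc k"] by auto
  then obtain z0 where z0: "z0 \<in> Z" by auto
  have adj_base: "(x, y) \<in> parcs G" if "i < j" "j < k" "x \<in> Xs ! i" "y \<in> Xs ! j" for i j x y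
  proof -
    have "i < k" "i \<noteq> j" using that by auto
    with transversal[of i j x y] that(2-4)
    obtain xs where xs: "xs \<in> listset Xs" "xs ! i = x" "xs ! j = y" by blast
    have "sorted_wrt (\<lambda>x y. (x, y) \<in> parcs G) xs" "length xs = k"
      using clique[OF z0 xs(1)] by (auto simp: cliques_def)
    then show ?thesis using sorted_wrt_nth_less[of _ xs i j] that xs by auto
  qed
  have adj_Z: "(z, x) \<in> parcs G" if "i < k" "x \<in> Xs ! i" "z \<in> Z" for i x z
  proof -
    obtain xs where xs: "xs \<in> listset Xs" "xs ! i = x" using transversal[of i i x x] \<open>i < k\<close> \<open>x \<in> Xs ! i\<close> by blast
    then show ?thesis using clique[OF that(3) xs(1)] that by (auto simp: cliques_def)
  qed
  have sym: "(y, x) \<in> parcs G" if "(x, y) \<in> parcs G" for x y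
    using pair_sym_arcs that by (auto simp: symmetric_def dest: symD)
  define X where "X i = (if i = Suc k then Z else Xs ! (i - 1))" for i
  have adj: "(x, y) \<in> parcs G" if "i \<in> {1..Suc k}" "j \<in> {1..Suc k}" "i < j" "x \<in> X i" "y \<in> X j" for i j x y
    using that adj_base[of "i - 1" "j - 1" x y] adj_Z[of "i - 1" x y] sym
    by (auto simp: X_def split: if_splits)
  have "\<not> graph_free (complete_multipartite_graph (Suc k) s) G"
  proof (rule complete_multipartite_copy[OF G])
    show "X i \<subseteq> pverts G \<and> card (X i) = s i" if "i \<in> {1..Suc k}" for i
    proof (cases "i = Suc k")
      case False
      then have "i - 1 < k" using that by auto
      then show ?thesis using nth[of "i - 1"] False that by (simp add: X_def)
    qed (use Z in \<open>auto simp: X_def\<close>)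
    show "(x, y) \<in> parcs G" if "i \<in> {1..Suc k}" "j \<in> {1..Suc k}" "i \<noteq> j" "x \<in> X i" "y \<in> X j" for i j x y
      using that adj[of i j x y] adj[of j i y x] sym by (cases "i < j") auto
  qed
  then show False using free by simp
qed

theorem theorem1p1:
  fixes r :: nat and s :: "nat \<Rightarrow> nat"
  assumes "3 \<le> r"
    and "\<forall>i\<in>{1..r}. 0 < s i"
    and "mono_on {1..r} s"
  shows "(\<lambda>n. real (gen_turan n (complete_graph r) (complete_multipartite_graph r s)))
           \<in> o(\<lambda>n. real n powr (real r - 1 / real (\<Prod>i=1..r-1. s i)))"
proof (rule landau_o.smallI)
  fix c :: real assume c: "c > 0"
  let ?H = "complete_multipartite_graph r s"
  obtain k where k: "r = Suc k" using assms(1) by (cases r) auto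
  define ss where "ss = map s [1..<Suc k]"
  have len: "length ss = k" by (simp add: ss_def)
  have prod: "prod_list ss = (\<Prod>i=1..r-1. s i)"
    unfolding ss_def by (simp add: prod.distinct_set_conv_list[symmetric] k atLeastLessThanSuc_atLeastAtMost
        del: upt_Suc)
  have arcs: "parcs ?H \<noteq> {}"
  proof -
    have "((1, 0), (2, 0)) \<in> parcs ?H"
      using assms by (auto simp: complete_multipartite_graph_def Let_def)
    then show ?thesis by blast
  qed
  have "\<forall>\<^sub>F n in sequentially. \<forall>(V :: nat set) R. finite V \<longrightarrow> card V = n \<longrightarrow> sym R \<longrightarrow>
    (\<forall>Xs\<in>set_families V ss. card {x\<in>V. \<forall>xs\<in>listset Xs. x # xs \<in> cliques V R (Suc (length ss))} \<le> s r) \<longrightarrow>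
    card (cliques V R (Suc (length ss))) \<le> c * n powr (Suc (length ss) - 1 / real (prod_list ss))"
  proof (rule card_cliques_small_o)
    show "0 \<notin> set ss"
    proof
      assume "0 \<in> set ss"
      then obtain i where "i \<in> {1..<Suc k}" "s i = 0" by (auto simp: ss_def simp del: upt_Suc)
      then show False using assms(2) by (force simp: k)
    qed
  qed (use assms c in \<open>auto simp: ss_def k\<close>)
  then show "\<forall>\<^sub>F n in sequentially. norm (real (gen_turan n (complete_graph r) ?H))
      \<le> c * norm (real n powr (real r - 1 / real (\<Prod>i=1..r-1. s i)))"
  proof eventually_elim
    case (elim n)
    have "gen_turan n (complete_graph r) ?H \<in> {card (copies (complete_graph r) G) | G :: nat pair_pre_digraph.
            pair_graph G \<and> card (pverts G) = n \<and> graph_free ?H G}"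
      unfolding gen_turan_def by (rule Max_in[OF gen_turan_finite gen_turan_nonempty[OF arcs]])
    then obtain G :: "nat pair_pre_digraph" where G: "pair_graph G" "card (pverts G) = n" "graph_free ?H G"
      and eq: "gen_turan n (complete_graph r) ?H = card (copies (complete_graph r) G)" by blast
    interpret pair_graph G by fact
    have "card (copies (complete_graph r) G) \<le> card (cliques (pverts G) (parcs G) r)"
      by (rule card_copies_complete_le[OF G(1)])
    also have "real \<dots> \<le> c * n powr (Suc (length ss) - 1 / real (prod_list ss))"
    proof -
      have "sym (parcs G)" using pair_sym_arcs by (simp add: symmetric_def)
      moreover have "card {x\<in>pverts G. \<forall>xs\<in>listset Xs. x # xs \<in> cliques (pverts G) (parcs G) (Suc (length ss))} \<le> s r"
        if "Xs \<in> set_families (pverts G) ss" for Xs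
        using card_common_extension_le[of G k s Xs] G that assms(2) by (simp add: k len ss_def del: upt_Suc)
      ultimately show ?thesis using elim[rule_format, of "pverts G" "parcs G"] G(2) pair_finite_verts
        by (simp add: k len)
    qed
    finally show ?case unfolding eq by (simp add: k len prod)
  qed
qed

end
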